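(* For all $0\le i\le n$ and all $D=\sum_{j=1}^n\xi_j(1+x_j)\partial_j\in\mathfrak{t}_0$ one has $\Delta_i(D)=\det M_i(\xi_1,\ldots,\xi_n)=\varphi_i(D)$. In particular, the restriction of $\Delta_0$ to $\mathfrak{t}_0$ is $\varphi_0$, the Dickson semiinvariant for $\mathrm{GL}_n(\mathbb{F}_p)$, and for $1\le i\le n$ the restriction of $\psi_{i-1}$ to $\mathfrak{t}_0$ is $\bar{\psi}_{i-1}=-\varphi_i/\varphi_0$.
   Context: Let $\Bbbk$ be an algebraically closed field of characteristic $p>2$, let $n\ge 1$, and assume $(p,n)\ne(3,1)$. Let $\mathcal{O}_n=\Bbbk[X_1,\ldots,X_n]/(X_1^p,\ldots,X_n^p)$, and let $x_i$ be the image of $X_i$. Let $\mathcal{L}=\mathrm{Der}(\mathcal{O}_n)$ be the Lie algebra of $\Bbbk$-linear derivations of $\mathcal{O}_n$, a free $\mathcal{O}_n$-module with basis $\partial_1,\ldots,\partial_n$, where $\partial_i(x_j)=\delta_{ij}$; for $D\in\mathcal{L}$ all powers $D^{p^k}$ (as endomorphisms of $\mathcal{O}_n$) again lie in $\mathcal{L}$. Let $\mathfrak{t}_0$ be the $\Bbbk$-span of $(1+x_1)\partial_1,\ldots,(1+x_n)\partial_n$ in $\mathcal{L}$. It is known (Premet) that for every $x\in\mathcal{L}$ one has $\det(tI_{\mathcal{O}_n}-x)=t^{p^n}+\sum_{i=0}^{n-1}\psi_i(x)t^{p^i}$, which defines homogeneous polynomial functions $\psi_0,\ldots,\psi_{n-1}\in\Bbbk[\mathcal{L}]$.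 Give $\mathcal{L}$ the $\mathbb{Z}$-grading $\mathcal{L}=\bigoplus_{i\ge-1}\mathcal{L}_i$ in which $x_1^{a_1}\cdots x_n^{a_n}\partial_j$ (with $0\le a_k\le p-1$) has degree $a_1+\cdots+a_n-1$, and give $\wedge^n\mathcal{L}$ (over $\Bbbk$) the induced grading $\bigoplus_{i\ge-n}(\wedge^n\mathcal{L})_i$, so that $(\wedge^n\mathcal{L})_{-n}=\Bbbk(\partial_1\wedge\cdots\wedge\partial_n)$. Define homogeneous polynomial functions $\Delta_0,\ldots,\Delta_n\in\Bbbk[\mathcal{L}]$ as follows: for all $D\in\mathcal{L}$, $\Delta_0(D)(\partial_1\wedge\cdots\wedge\partial_n)$ is the component in $(\wedge^n\mathcal{L})_{-n}$ of $D\wedge D^p\wedge\cdots\wedge D^{p^{n-1}}$, and, for $1\le i\le n$, $\Delta_i(D)(\partial_1\wedge\cdots\wedge\partial_n)$ is the component in $(\wedge^n\mathcal{L})_{-n}$ of the element obtained from $D\wedge D^p\wedge\cdots\wedge D^{p^{n-1}}$ by replacing its $i$-th factor $D^{p^{i-1}}$ by $D^{p^n}$. For $(\xi_1,\ldots,\xi_n)\in\mathbb{A}^n$ let $M_0(\xi_1,\ldots,\xi_n)$ be the $n\times n$ matrix whose $k$-th row is $(\xi_1^{p^{k-1}},\ldots,\xi_n^{p^{k-1}})$, $1\le k\le n$, and for $1\le i\le n$ let $M_i(\xi_1,\ldots,\xi_n)$ be the matrix obtained from $M_0(\xi_1,\ldots,\xi_n)$ by replacing its $i$-th row by $(\xi_1^{p^n},\ldots,\xi_n^{p^n})$.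 For $0\le i\le n$ define $\varphi_i\in\Bbbk[\mathfrak{t}_0]$ by $\varphi_i\big(\sum_{j=1}^n\xi_j(1+x_j)\partial_j\big)=\det M_i(\xi_1,\ldots,\xi_n)$. By Dickson, $\bar{\psi}_{i-1}:=-\varphi_i/\varphi_0$ is a polynomial function on $\mathfrak{t}_0$ for $1\le i\le n$. *)

theory Defs
  imports "Jordan_Normal_Form.Char_Poly" "HOL-Library.Poly_Mapping" "HOL-Library.FuncSet"
    "HOL-Library.Cardinality"
begin

text \<open>
  The number of variables is \<open>n = CARD('n)\<close>, the variables being indexed by the finite linearly
  ordered type \<open>'n\<close>; the characteristic is \<open>p = CHAR('k)\<close>.  Lists, vectors and matrices are
  indexed from 0, so \<open>idx j\<close> (the \<open>j\<close>-th smallest index, \<open>j < n\<close>) labels the variable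
  that is written $x_{j+1}$ when variables are numbered from 1.
\<close>

definition idx :: "nat \<Rightarrow> 'n::{finite,linorder}" where
  "idx j = sorted_list_of_set UNIV ! j"


subsection \<open>The truncated polynomial ring\<close>

type_synonym ('n, 'k) mpol = "('n \<Rightarrow>\<^sub>0 nat) \<Rightarrow>\<^sub>0 'k"

definition Var :: "'n \<Rightarrow> ('n, 'k::comm_ring_1) mpol" where
  "Var i = Poly_Mapping.single (Poly_Mapping.single i 1) 1"

definition Const :: "'k \<Rightarrow> ('n, 'k::comm_ring_1) mpol" where
  "Const c = Poly_Mapping.single 0 c"

definition trunc_ideal :: "('n::finite, 'k::field_prime_char) mpol set" where
  "trunc_ideal = {f. \<exists>c. f = (\<Sum>i\<in>UNIV. c i * Var i ^ CHAR('k))}"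

lemma trunc_ideal_0: "0 \<in> trunc_ideal"
  unfolding trunc_ideal_def by (auto intro!: exI[of _ "\<lambda>_. 0"])

lemma trunc_ideal_add: "f \<in> trunc_ideal \<Longrightarrow> g \<in> trunc_ideal \<Longrightarrow> f + g \<in> trunc_ideal"
  unfolding trunc_ideal_def
proof clarsimp
  fix c d :: "'a \<Rightarrow> ('a, 'b) mpol"
  show "\<exists>e. (\<Sum>i\<in>UNIV. c i * Var i ^ CHAR('b)) + (\<Sum>i\<in>UNIV. d i * Var i ^ CHAR('b)) =
      (\<Sum>i\<in>UNIV. e i * Var i ^ CHAR('b))"
    by (rule exI[of _ "\<lambda>i. c i + d i"]) (simp add: distrib_right sum.distrib)
qed

lemma trunc_ideal_mult: "f \<in> trunc_ideal \<Longrightarrow> g * f \<in> trunc_ideal"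
  unfolding trunc_ideal_def
proof clarsimp
  fix c :: "'a \<Rightarrow> ('a, 'b) mpol"
  show "\<exists>e. g * (\<Sum>i\<in>UNIV. c i * Var i ^ CHAR('b)) = (\<Sum>i\<in>UNIV. e i * Var i ^ CHAR('b))"
    by (rule exI[of _ "\<lambda>i. g * c i"]) (simp add: sum_distrib_left mult.assoc)
qed

lemma trunc_ideal_uminus: "f \<in> trunc_ideal \<Longrightarrow> - f \<in> trunc_ideal"
  using trunc_ideal_mult[of f "-1"] by simp

lemma trunc_ideal_diff: "f \<in> trunc_ideal \<Longrightarrow> g \<in> trunc_ideal \<Longrightarrow> f - g \<in> trunc_ideal"
  using trunc_ideal_add[of f "- g"] trunc_ideal_uminus[of g] by simp

lemma Var_power: "Var i ^ m = Poly_Mapping.single (Poly_Mapping.single i m) 1"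
proof (induction m)
  case (Suc m)
  then show ?case
    by (simp add: Var_def mult_single flip: single_add)
qed simp

lemma lookup_0_mult_Var_power:
  fixes f :: "('n, 'k::comm_ring_1) mpol"
  assumes "m > 0"
  shows "Poly_Mapping.lookup (f * Var i ^ m) 0 = 0"
proof (rule ccontr)
  assume "\<not> ?thesis"
  then have "0 \<in> Poly_Mapping.keys (f * Var i ^ m)"
    by (simp add: Poly_Mapping.in_keys_iff)
  then obtain a b where "b \<in> Poly_Mapping.keys (Var i ^ m :: ('n, 'k) mpol)" and 0: "0 = a + b"
    using keys_mult[of f "Var i ^ m"] by blast
  then have "b = Poly_Mapping.single i m"
    by (auto simp: Var_power split: if_splits)
  with 0 have "Poly_Mapping.lookup (0 :: 'n \<Rightarrow>\<^sub>0 nat) i = Poly_Mapping.lookup a i + m"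
    by (metis lookup_add lookup_single_eq)
  with assms show False by simp
qed

lemma one_notin_trunc_ideal: "(1 :: ('n::finite, 'k::field_prime_char) mpol) \<notin> trunc_ideal"
proof
  assume "(1 :: ('n, 'k) mpol) \<in> trunc_ideal"
  then obtain c where c: "(1 :: ('n, 'k) mpol) = (\<Sum>i\<in>UNIV. c i * Var i ^ CHAR('k))"
    by (auto simp: trunc_ideal_def)
  have "CHAR('k) > 0" by simp
  have "Poly_Mapping.lookup (1 :: ('n, 'k) mpol) 0 =
      (\<Sum>i\<in>UNIV. Poly_Mapping.lookup (c i * Var i ^ CHAR('k)) 0)"
    by (subst c) (simp add: lookup_sum)
  also have "\<dots> = 0"
    by (intro sum.neutral ballI lookup_0_mult_Var_power[OF \<open>CHAR('k) > 0\<close>])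
  finally show False by simp
qed

quotient_type (overloaded) ('n, 'k) trunc = "('n::finite, 'k::field_prime_char) mpol" /
  "\<lambda>f g. f - g \<in> trunc_ideal"
proof (rule equivpI)
  show "reflp (\<lambda>f g :: ('n, 'k) mpol. f - g \<in> trunc_ideal)"
    by (rule reflpI) (simp add: trunc_ideal_0)
  show "symp (\<lambda>f g :: ('n, 'k) mpol. f - g \<in> trunc_ideal)"
    by (rule sympI) (metis trunc_ideal_uminus minus_diff_eq)
  show "transp (\<lambda>f g :: ('n, 'k) mpol. f - g \<in> trunc_ideal)"
    by (rule transpI) (use trunc_ideal_add in fastforce)
qed

instantiation trunc :: (finite, field_prime_char) comm_ring_1
begin

lift_definition zero_trunc :: "('a, 'b) trunc" is 0 .
lift_definition one_trunc :: "('a, 'b) trunc" is 1 .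
lift_definition plus_trunc :: "('a, 'b) trunc \<Rightarrow> ('a, 'b) trunc \<Rightarrow> ('a, 'b) trunc" is "(+)"
  by (metis add_diff_add trunc_ideal_add)
lift_definition minus_trunc :: "('a, 'b) trunc \<Rightarrow> ('a, 'b) trunc \<Rightarrow> ('a, 'b) trunc" is "(-)"
proof -
  fix f f' g g' :: "('a, 'b) mpol"
  assume "f - f' \<in> trunc_ideal" "g - g' \<in> trunc_ideal"
  then have "(f - f') - (g - g') \<in> trunc_ideal" by (rule trunc_ideal_diff)
  then show "(f - g) - (f' - g') \<in> trunc_ideal" by (simp add: algebra_simps)
qed
lift_definition uminus_trunc :: "('a, 'b) trunc \<Rightarrow> ('a, 'b) trunc" is "uminus"
  by (metis minus_diff_minus trunc_ideal_uminus)
lift_definition times_trunc :: "('a, 'b) trunc \<Rightarrow> ('a, 'b) trunc \<Rightarrow> ('a, 'b) trunc" is "(*)"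
proof -
  fix f f' g g' :: "('a, 'b) mpol"
  assume "f - f' \<in> trunc_ideal" "g - g' \<in> trunc_ideal"
  then have "g * (f - f') + f' * (g - g') \<in> trunc_ideal"
    by (intro trunc_ideal_add trunc_ideal_mult)
  then show "f * g - f' * g' \<in> trunc_ideal" by (simp add: algebra_simps)
qed

instance
proof
  show "(0 :: ('a, 'b) trunc) \<noteq> 1"
    by transfer (metis one_notin_trunc_ideal trunc_ideal_uminus diff_0 minus_minus)
qed (transfer; simp add: algebra_simps trunc_ideal_0)+

end

lift_definition trunc_const :: "'k \<Rightarrow> ('n::finite, 'k::field_prime_char) trunc" is Const .

lift_definition xvar :: "'n \<Rightarrow> ('n::finite, 'k::field_prime_char) trunc" is Var .

definition trunc_scale :: "'k \<Rightarrow> ('n, 'k) trunc \<Rightarrow> ('n::finite, 'k::field_prime_char) trunc" where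
  "trunc_scale c f = trunc_const c * f"

lemma trunc_const_add: "trunc_const (a + b) = trunc_const a + trunc_const b"
  by transfer (simp add: Const_def single_add trunc_ideal_0)

lemma trunc_const_mult: "trunc_const (a * b) = trunc_const a * trunc_const b"
  by transfer (simp add: Const_def mult_single trunc_ideal_0)

lemma trunc_const_1: "trunc_const 1 = 1"
  by transfer (simp add: Const_def trunc_ideal_0)

global_interpretation trunc: vector_space trunc_scale
  by standard (simp_all add: trunc_scale_def trunc_const_add trunc_const_mult trunc_const_1
      algebra_simps)


lemma trunc_scale_times:
  "trunc_scale c f * g = trunc_scale c (f * g)" "f * trunc_scale c g = trunc_scale c (f * g)"
  by (simp_all add: trunc_scale_def algebra_simps)

lemmas trunc_scale_simps = trunc_scale_times trunc.scale_right_distrib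
  trunc.scale_right_diff_distrib trunc.scale_minus_right


subsection \<open>Derivations\<close>

definition is_derivation ::
    "(('n, 'k) trunc \<Rightarrow> ('n::finite, 'k::field_prime_char) trunc) \<Rightarrow> bool" where
  "is_derivation D \<longleftrightarrow>
     (\<forall>f g. D (f + g) = D f + D g) \<and>
     (\<forall>c f. D (trunc_scale c f) = trunc_scale c (D f)) \<and>
     (\<forall>f g. D (f * g) = D f * g + f * D g)"

typedef (overloaded) ('n, 'k) der =
  "{D :: ('n::finite, 'k::field_prime_char) trunc \<Rightarrow> ('n, 'k) trunc. is_derivation D}"
  morphisms der_app Der
  by (rule exI[of _ "\<lambda>_. 0"]) (simp add: is_derivation_def)

setup_lifting type_definition_der

instantiation der :: (finite, field_prime_char) ab_group_add
begin

lift_definition zero_der :: "('a, 'b) der" is "\<lambda>_. 0"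
  by (simp add: is_derivation_def)
lift_definition plus_der :: "('a, 'b) der \<Rightarrow> ('a, 'b) der \<Rightarrow> ('a, 'b) der" is
  "\<lambda>D E f. D f + E f"
  by (simp add: is_derivation_def trunc_scale_simps algebra_simps)
lift_definition minus_der :: "('a, 'b) der \<Rightarrow> ('a, 'b) der \<Rightarrow> ('a, 'b) der" is
  "\<lambda>D E f. D f - E f"
  by (simp add: is_derivation_def trunc_scale_simps algebra_simps)
lift_definition uminus_der :: "('a, 'b) der \<Rightarrow> ('a, 'b) der" is "\<lambda>D f. - D f"
  by (simp add: is_derivation_def trunc_scale_simps algebra_simps)

instance
  by standard (transfer; simp add: fun_eq_iff algebra_simps)+

end

text \<open>The action of the truncated polynomial ring on its derivations.\<close>

definition der_mult ::
    "('n, 'k) trunc \<Rightarrow> ('n, 'k) der \<Rightarrow> ('n::finite, 'k::field_prime_char) der" where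
  "der_mult g D = Der (\<lambda>f. g * der_app D f)"

lemma der_app_der_mult [simp]: "der_app (der_mult g D) f = g * der_app D f"
proof -
  have "is_derivation (\<lambda>f. g * der_app D f)"
    using der_app[of D] by (simp add: is_derivation_def trunc_scale_simps algebra_simps)
  then show ?thesis by (simp add: der_mult_def Der_inverse)
qed

definition der_scale :: "'k \<Rightarrow> ('n, 'k) der \<Rightarrow> ('n::finite, 'k::field_prime_char) der" where
  "der_scale c = der_mult (trunc_const c)"

global_interpretation der: vector_space der_scale
  by standard (auto simp: der_app_inject[symmetric] der_scale_def fun_eq_iff plus_der.rep_eq
      trunc_const_add trunc_const_mult trunc_const_1 algebra_simps)

definition partial :: "'n \<Rightarrow> ('n::finite, 'k::field_prime_char) der" where
  "partial i = (THE D. \<forall>j. der_app D (xvar j) = (if i = j then 1 else 0))"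

text \<open>
  The \<open>m\<close>-th power of a derivation as an endomorphism.  This is again a derivation when
  \<open>m\<close> is a power of \<open>p\<close>, the only case that is used (for other \<open>m\<close> the value is unspecified).
\<close>

definition der_power :: "('n, 'k) der \<Rightarrow> nat \<Rightarrow> ('n::finite, 'k::field_prime_char) der" where
  "der_power D m = Der (der_app D ^^ m)"

definition der_homog :: "int \<Rightarrow> ('n::finite, 'k::field_prime_char) der set" where
  "der_homog d = der.span
     {der_mult (\<Prod>i\<in>UNIV. xvar i ^ a i) (partial j) | a j.
        (\<forall>i. a i \<le> CHAR('k) - 1) \<and> int (\<Sum>i\<in>UNIV. a i) - 1 = d}"


subsection \<open>Characteristic polynomials\<close>

text \<open>
  \<open>det(t I - F)\<close> for a linear endomorphism of the finite-dimensional space of truncated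
  polynomials: the characteristic polynomial of its matrix in an arbitrary ordered basis.
\<close>

definition trunc_basis :: "('n::finite, 'k::field_prime_char) trunc list \<Rightarrow> bool" where
  "trunc_basis bs \<longleftrightarrow>
     distinct bs \<and> trunc.independent (set bs) \<and> trunc.span (set bs) = UNIV"

definition trunc_matrix ::
    "('n, 'k) trunc list \<Rightarrow> (('n, 'k) trunc \<Rightarrow> ('n::finite, 'k::field_prime_char) trunc) \<Rightarrow> 'k mat"
  where
  "trunc_matrix bs F = mat (length bs) (length bs)
     (\<lambda>(r, s). trunc.representation (set bs) (F (bs ! s)) (bs ! r))"

definition trunc_char_poly ::
    "(('n, 'k) trunc \<Rightarrow> ('n::finite, 'k::field_prime_char) trunc) \<Rightarrow> 'k poly" where
  "trunc_char_poly F = char_poly (trunc_matrix (SOME bs. trunc_basis bs) F)"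

definition psi :: "nat \<Rightarrow> ('n::finite, 'k) der \<Rightarrow> 'k::field_prime_char" where
  "psi i D = poly.coeff (trunc_char_poly (der_app D)) (CHAR('k) ^ i)"


subsection \<open>The exterior algebra of the space of derivations\<close>

text \<open>
  The exterior algebra (as a graded vector space) is the free vector space on all finite lists of
  derivations, modulo multilinearity and vanishing on lists with a repeated entry.  The classes
  of lists of length \<open>m\<close> span the \<open>m\<close>-th exterior power.
\<close>

definition free_scale :: "'k \<Rightarrow> ('a \<Rightarrow>\<^sub>0 'k) \<Rightarrow> ('a \<Rightarrow>\<^sub>0 'k::field)" where
  "free_scale c = Poly_Mapping.map ((*) c)"

lemma lookup_free_scale [simp]:
  "Poly_Mapping.lookup (free_scale c f) x = c * Poly_Mapping.lookup f x"
  by (simp add: free_scale_def Poly_Mapping.map.rep_eq when_def)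

global_interpretation free: vector_space free_scale
  by standard (auto intro!: poly_mapping_eqI simp: lookup_add algebra_simps)

abbreviation gen :: "'a \<Rightarrow> ('a \<Rightarrow>\<^sub>0 'k::field)" where
  "gen x \<equiv> Poly_Mapping.single x 1"

definition ext_relations :: "(('n::finite, 'k::field_prime_char) der list \<Rightarrow>\<^sub>0 'k) set" where
  "ext_relations = free.span (
     {gen (as @ [D + E] @ bs) - gen (as @ [D] @ bs) - gen (as @ [E] @ bs) | as bs D E. True} \<union>
     {gen (as @ [der_scale c D] @ bs) - free_scale c (gen (as @ [D] @ bs)) | as bs c D. True} \<union>
     {gen ds | ds. \<not> distinct ds})"

lemma ext_relations_0: "0 \<in> ext_relations"
  unfolding ext_relations_def by (rule free.span_zero)

lemma ext_relations_add: "u \<in> ext_relations \<Longrightarrow> v \<in> ext_relations \<Longrightarrow> u + v \<in> ext_relations"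
  unfolding ext_relations_def by (rule free.span_add)

lemma ext_relations_uminus: "u \<in> ext_relations \<Longrightarrow> - u \<in> ext_relations"
  unfolding ext_relations_def by (rule free.span_neg)

lemma ext_relations_scale: "u \<in> ext_relations \<Longrightarrow> free_scale c u \<in> ext_relations"
  unfolding ext_relations_def by (rule free.span_scale)

quotient_type (overloaded) ('n, 'k) ext = "('n::finite, 'k::field_prime_char) der list \<Rightarrow>\<^sub>0 'k" /
  "\<lambda>u v. u - v \<in> ext_relations"
proof (rule equivpI)
  show "reflp (\<lambda>u v :: ('n, 'k) der list \<Rightarrow>\<^sub>0 'k. u - v \<in> ext_relations)"
    by (rule reflpI) (simp add: ext_relations_0)
  show "symp (\<lambda>u v :: ('n, 'k) der list \<Rightarrow>\<^sub>0 'k. u - v \<in> ext_relations)"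
    by (rule sympI) (metis ext_relations_uminus minus_diff_eq)
  show "transp (\<lambda>u v :: ('n, 'k) der list \<Rightarrow>\<^sub>0 'k. u - v \<in> ext_relations)"
    by (rule transpI) (use ext_relations_add in fastforce)
qed

instantiation ext :: (finite, field_prime_char) ab_group_add
begin

lift_definition zero_ext :: "('a, 'b) ext" is 0 .
lift_definition plus_ext :: "('a, 'b) ext \<Rightarrow> ('a, 'b) ext \<Rightarrow> ('a, 'b) ext" is "(+)"
  by (metis add_diff_add ext_relations_add)
lift_definition minus_ext :: "('a, 'b) ext \<Rightarrow> ('a, 'b) ext \<Rightarrow> ('a, 'b) ext" is "(-)"
proof -
  fix f f' g g' :: "('a, 'b) der list \<Rightarrow>\<^sub>0 'b"
  assume "f - f' \<in> ext_relations" "g - g' \<in> ext_relations"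
  then have "(f - f') - (g - g') \<in> ext_relations"
    using ext_relations_add[OF _ ext_relations_uminus] by (metis add_uminus_conv_diff)
  then show "(f - g) - (f' - g') \<in> ext_relations" by (simp add: algebra_simps)
qed
lift_definition uminus_ext :: "('a, 'b) ext \<Rightarrow> ('a, 'b) ext" is "uminus"
  by (metis minus_diff_minus ext_relations_uminus)

instance
  by standard (transfer; simp add: algebra_simps ext_relations_0)+

end

lift_definition ext_scale :: "'k \<Rightarrow> ('n, 'k) ext \<Rightarrow> ('n::finite, 'k::field_prime_char) ext" is
  free_scale
  by (metis free.scale_right_diff_distrib ext_relations_scale)

global_interpretation ext: vector_space ext_scale
  by standard (transfer; simp add: free.scale_right_distrib free.scale_left_distrib
      ext_relations_0)+

definition wedge :: "('n, 'k) der list \<Rightarrow> ('n::finite, 'k::field_prime_char) ext" where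
  "wedge ds = abs_ext (gen ds)"

text \<open>The homogeneous components of the \<open>n\<close>-th exterior power.\<close>

definition wedge_homog :: "int \<Rightarrow> ('n::finite, 'k::field_prime_char) ext set" where
  "wedge_homog d = ext.span
     {wedge ds | ds. length ds = CARD('n) \<and>
        (\<exists>e. (\<forall>i<CARD('n). ds ! i \<in> der_homog (e i)) \<and> (\<Sum>i<CARD('n). e i) = d)}"

definition wedge_component ::
    "int \<Rightarrow> ('n, 'k) ext \<Rightarrow> ('n::finite, 'k::field_prime_char) ext" where
  "wedge_component d w =
     (THE u. u \<in> wedge_homog d \<and> (\<exists>v\<in>ext.span (\<Union>d'\<in>-{d}. wedge_homog d'). w = u + v))"

definition power_list :: "('n, 'k) der \<Rightarrow> ('n::finite, 'k::field_prime_char) der list" where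
  "power_list D = map (\<lambda>k. der_power D (CHAR('k) ^ k)) [0..<CARD('n)]"

definition delta_list :: "nat \<Rightarrow> ('n, 'k) der \<Rightarrow> ('n::finite, 'k::field_prime_char) der list" where
  "delta_list i D =
     (if i = 0 then power_list D
      else (power_list D)[i - 1 := der_power D (CHAR('k) ^ CARD('n))])"

definition Delta :: "nat \<Rightarrow> ('n::{finite,linorder}, 'k) der \<Rightarrow> 'k::field_prime_char" where
  "Delta i D = (THE c.
     wedge_component (- int CARD('n)) (wedge (delta_list i D)) =
       ext_scale c (wedge (map (\<lambda>j. partial (idx j)) [0..<CARD('n)])))"


subsection \<open>The torus and the Dickson polynomials\<close>

definition toral_basis :: "nat \<Rightarrow> ('n::{finite,linorder}, 'k::field_prime_char) der" where
  "toral_basis j = der_mult (1 + xvar (idx j)) (partial (idx j))"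

definition toral :: "('n::{finite,linorder}, 'k::field_prime_char) der set" where
  "toral = der.span (toral_basis ` {..<CARD('n)})"

definition toral_elt :: "'k vec \<Rightarrow> ('n::{finite,linorder}, 'k::field_prime_char) der" where
  "toral_elt \<xi> = (\<Sum>j<CARD('n). der_scale (\<xi> $ j) (toral_basis j))"

definition dickson_mat :: "nat \<Rightarrow> 'k vec \<Rightarrow> 'k::field_prime_char mat" where
  "dickson_mat i \<xi> = mat (dim_vec \<xi>) (dim_vec \<xi>)
     (\<lambda>(k, j). (\<xi> $ j) ^ (CHAR('k) ^ (if k + 1 = i then dim_vec \<xi> else k)))"

text \<open>Functions on the torus are represented as extensional functions.\<close>

definition phi :: "nat \<Rightarrow> ('n::{finite,linorder}, 'k) der \<Rightarrow> 'k::field_prime_char" where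
  "phi i = (\<lambda>D\<in>toral. det (dickson_mat i (THE \<xi>. \<xi> \<in> carrier_vec CARD('n) \<and> D = toral_elt \<xi>)))"

definition mpol_eval :: "('n \<Rightarrow> 'k) \<Rightarrow> ('n::finite, 'k::comm_ring_1) mpol \<Rightarrow> 'k" where
  "mpol_eval a P =
     (\<Sum>m\<in>Poly_Mapping.keys P.
        Poly_Mapping.lookup P m * (\<Prod>i\<in>UNIV. a i ^ Poly_Mapping.lookup m i))"

definition poly_fun_toral ::
    "(('n::{finite,linorder}, 'k) der \<Rightarrow> 'k::field_prime_char) set" where
  "poly_fun_toral = {f \<in> extensional toral. \<exists>P :: ('n, 'k) mpol.
     \<forall>a. f (\<Sum>j<CARD('n). der_scale (a (idx j)) (toral_basis j)) = mpol_eval a P}"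

text \<open>
  The polynomial function \<open>- phi (i + 1) / phi 0\<close> on the torus, i.e. the quotient of these two
  elements of the integral domain of polynomial functions.
\<close>

definition psi_bar :: "nat \<Rightarrow> ('n::{finite,linorder}, 'k) der \<Rightarrow> 'k::field_prime_char" where
  "psi_bar i =
     (THE f. f \<in> poly_fun_toral \<and> (\<forall>D\<in>toral. phi 0 D * f D = - phi (i + 1) D))"

text \<open>The general linear group over the prime field, inside matrices over \<open>'k\<close>.\<close>

definition GL_prime :: "nat \<Rightarrow> 'k::field_prime_char mat set" where
  "GL_prime n = {g \<in> carrier_mat n n. elements_mat g \<subseteq> range of_int \<and> det g \<noteq> 0}"

end

theory Submission
  imports Defs
begin

text \<open>
  In terms of $y_i = 1 + x_i$, which satisfies $y_i^p = 1$, the element $D = \sum_i \xi_i y_i \partial_i$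
  of the torus is diagonal in the basis of monomials $y^a$ ($0 \le a_i < p$), with eigenvalues
  $\sum_i a_i \xi_i$.  Hence $D^{p^k} = \sum_i \xi_i^{p^k} y_i \partial_i$, and the coefficient of
  $\partial_1 \wedge \cdots \wedge \partial_n$ in a wedge product is the determinant of the constant
  terms of the values at the $x_j$; this gives $\Delta_i(D)$.

  The characteristic polynomial of $D$ is the product of $t - \sum_i a_i \xi_i$ over all $a$.
  Adding one variable at a time and using $\prod_{c \in \mathbb{F}_p} (X - c Y) = X^p - Y^{p-1} X$, one
  sees that it is a combination of the $t^{p^k}$.  It vanishes at every $\xi_j$, which expresses the row
  $(\xi_j^{p^n})_j$ through the rows of $M_0$ with coefficients $- \psi_k(D)$, so
  $\det M_i = - \psi_{i-1}(D) \det M_0$.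
\<close>

subsection \<open>Indexing of the variables\<close>

text \<open>Most functions in the statement are definite descriptions or choices, so computing a
  value means proving that it is determined. \<open>psi\<close> is read off in an arbitrary basis,
  hence the similarity argument. The exterior power is a quotient by relations, and its presentation
  does not show that the wedge of the coordinate derivations is nonzero; the functional
  \<open>wedge_coeff\<close>, built from determinants and checked against the relations, takes the
  value 1 there and kills every component of degree other than -n. The lowest component of the
  wedges in question can be written down because torus elements live in degrees -1 and 0 only.
  Finally, the relation between \<open>det M_i\<close> and \<open>det M_0\<close> is pointwise, and
  \<open>det M_0\<close> has zeros on the torus, so it does not by itself determine the quotient
  there. Uniqueness of \<open>psi_bar\<close> is a cancellation among polynomial functions, resting
  on the infinite field and on a point where \<open>det M_0\<close> is nonzero.\<close>

lemma bij_betw_idx: "bij_betw (idx :: nat \<Rightarrow> 'n::{finite,linorder}) {..<CARD('n)} UNIV"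
  unfolding idx_def by (rule bij_betw_nth) auto

lemma idx_eq_iff [simp]:
  assumes "i < CARD('n)" "j < CARD('n)"
  shows "(idx i :: 'n::{finite,linorder}) = idx j \<longleftrightarrow> i = j"
  using assms bij_betw_idx[where ?'n = 'n] by (auto simp: bij_betw_def inj_on_def)

lemma sum_idx: "(\<Sum>j<CARD('n). f (idx j :: 'n::{finite,linorder})) = (\<Sum>i\<in>UNIV. f i)"
  by (rule sum.reindex_bij_betw[OF bij_betw_idx])

lemma ex_fun_idx: "\<exists>a :: 'n::{finite,linorder} \<Rightarrow> 'b. \<forall>j<CARD('n). a (idx j) = f j"
proof -
  have "inv_into {..<CARD('n)} idx (idx j :: 'n) = j" if "j < CARD('n)" for j
    using that bij_betw_idx[where ?'n = 'n] by (auto simp: bij_betw_def)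
  then show ?thesis
    by (intro exI[of _ "\<lambda>i. f (inv_into {..<CARD('n)} idx i)"]) auto
qed


subsection \<open>Linear functionals on free modules and evaluation of polynomials\<close>

lemma poly_mapping_induct_single [case_names zero single add]:
  assumes "P 0" "\<And>k c. P (Poly_Mapping.single k c)" "\<And>f g. P f \<Longrightarrow> P g \<Longrightarrow> P (f + g)"
  shows "P (f :: 'a \<Rightarrow>\<^sub>0 'b::comm_monoid_add)"
proof (induction f rule: update_induct)
  case (update f a b)
  have "Poly_Mapping.update a b f = f + Poly_Mapping.single a b"
    using update(1) by (intro poly_mapping_eqI)
      (auto simp: lookup_update lookup_add lookup_single in_keys_iff when_def)
  then show ?case using assms update by auto
qed (fact assms)

text \<open>The linear extension of \<open>g\<close> from the basis to the free module. It serves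
  twice: for evaluating polynomials (basis of monomials) and for functionals on the presentation of
  the exterior algebra (basis of lists).\<close>

definition pm_lin :: "('a \<Rightarrow> 'k) \<Rightarrow> ('a \<Rightarrow>\<^sub>0 'k) \<Rightarrow> 'k::comm_ring_1" where
  "pm_lin g P = (\<Sum>m\<in>Poly_Mapping.keys P. Poly_Mapping.lookup P m * g m)"

lemma pm_lin_superset:
  assumes "finite S" "Poly_Mapping.keys P \<subseteq> S"
  shows "pm_lin g P = (\<Sum>m\<in>S. Poly_Mapping.lookup P m * g m)"
  unfolding pm_lin_def using assms by (intro sum.mono_neutral_left) (auto simp: in_keys_iff)

lemma pm_lin_0 [simp]: "pm_lin g 0 = 0"
  by (simp add: pm_lin_def)

lemma pm_lin_single [simp]: "pm_lin g (Poly_Mapping.single m c) = c * g m"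
  by (subst pm_lin_superset[of "{m}"]) auto

lemma pm_lin_add: "pm_lin g (P + Q) = pm_lin g P + pm_lin g Q"
proof -
  let ?S = "Poly_Mapping.keys P \<union> Poly_Mapping.keys Q"
  have "Poly_Mapping.keys (P + Q) \<subseteq> ?S" by (rule keys_add)
  then show ?thesis
    by (simp add: pm_lin_superset[of ?S] lookup_add distrib_right sum.distrib)
qed

lemma pm_lin_diff: "pm_lin g (P - Q) = pm_lin g P - pm_lin g Q"
  using pm_lin_add[of g "P - Q" Q] by (simp add: algebra_simps)

lemma pm_lin_free_scale: "pm_lin g (free_scale c P) = c * pm_lin g P"
proof -
  have "Poly_Mapping.keys (free_scale c P) \<subseteq> Poly_Mapping.keys P"
    by (auto simp: in_keys_iff)
  then show ?thesis
    by (subst pm_lin_superset[of "Poly_Mapping.keys P"])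
      (auto simp: pm_lin_def sum_distrib_left mult.assoc)
qed

lemma mpol_eval_pm_lin:
  "mpol_eval a = pm_lin (\<lambda>m. \<Prod>i\<in>UNIV. a i ^ Poly_Mapping.lookup m i)"
  by (simp add: mpol_eval_def pm_lin_def fun_eq_iff)

lemma mpol_eval_0: "mpol_eval a 0 = 0"
  and mpol_eval_add: "mpol_eval a (P + Q) = mpol_eval a P + mpol_eval a Q"
  by (simp_all add: mpol_eval_pm_lin pm_lin_add)

lemma mpol_eval_mult: "mpol_eval a (P * Q) = mpol_eval a P * mpol_eval a Q"
proof (induction P rule: poly_mapping_induct_single)
  case (single k c)
  show ?case
  proof (induction Q rule: poly_mapping_induct_single)
    case (single l d)
    show ?case
      by (simp add: mpol_eval_pm_lin mult_single lookup_add power_add prod.distrib)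
  qed (simp_all add: mpol_eval_0 mpol_eval_add distrib_left)
qed (simp_all add: mpol_eval_0 mpol_eval_add distrib_right)

lemma mpol_eval_Const [simp]: "mpol_eval a (Const c) = c"
  by (simp add: Const_def mpol_eval_pm_lin)

lemma mpol_eval_1 [simp]: "mpol_eval a 1 = 1"
  using mpol_eval_Const[of a 1] by (simp add: Const_def)

lemma prod_power_lookup_single:
  "(\<Prod>j\<in>UNIV. a j ^ Poly_Mapping.lookup (Poly_Mapping.single i m) j) = (a i ^ m :: 'a::comm_monoid_mult)"
    for i :: "'n::finite"
proof -
  have "(\<Prod>j\<in>UNIV. a j ^ Poly_Mapping.lookup (Poly_Mapping.single i m) j)
      = (\<Prod>j\<in>{i}. a j ^ Poly_Mapping.lookup (Poly_Mapping.single i m) j)"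
    by (rule prod.mono_neutral_right) (auto simp: lookup_single when_def)
  then show ?thesis by simp
qed

lemma mpol_eval_Var [simp]: "mpol_eval a (Var i) = a i"
  by (simp add: Var_def mpol_eval_pm_lin prod_power_lookup_single)

lemma comm_ring_hom_mpol_eval: "comm_ring_hom (mpol_eval a)"
  by unfold_locales (simp_all add: mpol_eval_0 mpol_eval_add mpol_eval_mult)


subsection \<open>The truncated polynomial ring\<close>

lemma sum_single_lookup:
  "(\<Sum>i\<in>UNIV. Poly_Mapping.single i (Poly_Mapping.lookup m i)) = (m :: 'n::finite \<Rightarrow>\<^sub>0 nat)"
proof (rule poly_mapping_eqI)
  fix k
  have "(\<Sum>i\<in>UNIV. Poly_Mapping.lookup (Poly_Mapping.single i (Poly_Mapping.lookup m i)) k) =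
      (\<Sum>i\<in>{k}. Poly_Mapping.lookup (Poly_Mapping.single i (Poly_Mapping.lookup m i)) k)"
    by (rule sum.mono_neutral_right) (auto simp: lookup_single when_def)
  then show "Poly_Mapping.lookup (\<Sum>i\<in>UNIV. Poly_Mapping.single i (Poly_Mapping.lookup m i)) k
      = Poly_Mapping.lookup m k"
    by (simp add: lookup_sum)
qed

lemma prod_Var_power:
  "finite A \<Longrightarrow> (\<Prod>i\<in>A. Var i ^ m i) = Poly_Mapping.single (\<Sum>i\<in>A. Poly_Mapping.single i (m i)) 1"
  by (induction A rule: finite_induct) (simp_all add: Var_power mult_single)

lemma single_eq_Const_prod_Var:
  "Poly_Mapping.single m c = Const c * (\<Prod>i\<in>UNIV. Var i ^ Poly_Mapping.lookup m (i::'n::finite))"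
  by (simp add: prod_Var_power sum_single_lookup Const_def mult_single)

lemma abs_trunc_mult: "abs_trunc (f * g) = abs_trunc f * abs_trunc g"
  and abs_trunc_add: "abs_trunc (f + g) = abs_trunc f + abs_trunc g"
  and abs_trunc_0: "abs_trunc 0 = 0"
  and abs_trunc_1: "abs_trunc 1 = 1"
  and abs_trunc_Const: "abs_trunc (Const c) = trunc_const c"
  and abs_trunc_Var: "abs_trunc (Var i) = xvar i"
  by (simp_all add: times_trunc.abs_eq plus_trunc.abs_eq zero_trunc.abs_eq one_trunc.abs_eq
      trunc_const.abs_eq xvar.abs_eq)

lemma abs_trunc_power: "abs_trunc (f ^ m) = abs_trunc f ^ m"
  by (induction m) (simp_all add: abs_trunc_1 abs_trunc_mult)

lemma abs_trunc_prod: "abs_trunc (\<Prod>i\<in>A. f i) = (\<Prod>i\<in>A. abs_trunc (f i))"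
  by (induction A rule: infinite_finite_induct) (simp_all add: abs_trunc_1 abs_trunc_mult)

text \<open>Every class has a polynomial representative, and each monomial is a product of a
  constant and variables. This is the form in which generation of the algebra by the
  \<open>xvar i\<close> is used.\<close>

lemma trunc_induct [case_names const var add mult]:
  fixes f :: "('n::finite, 'k::field_prime_char) trunc"
  assumes const: "\<And>c. P (trunc_const c)" and var: "\<And>i. P (xvar i)"
    and add: "\<And>f g. P f \<Longrightarrow> P g \<Longrightarrow> P (f + g)" and mult: "\<And>f g. P f \<Longrightarrow> P g \<Longrightarrow> P (f * g)"
  shows "P f"
proof -
  have 0: "P 0" and 1: "P 1"
    using const[of 0] const[of 1]
    by (simp_all add: Const_def abs_trunc_0 abs_trunc_1 flip: abs_trunc_Const)
  have power: "P (xvar i ^ m)" for i m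
    by (induction m) (simp_all add: 1 var mult)
  have prod: "P (\<Prod>i\<in>A. xvar i ^ m i)" for A :: "'n set" and m
    by (induction A rule: infinite_finite_induct) (simp_all add: 1 power mult)
  have "P (abs_trunc g)" for g
    by (induction g rule: poly_mapping_induct_single)
      (simp_all add: 0 abs_trunc_0 add abs_trunc_add single_eq_Const_prod_Var abs_trunc_mult
        abs_trunc_prod abs_trunc_Const abs_trunc_power abs_trunc_Var const mult prod)
  then show ?thesis by (metis Quotient3_abs_rep[OF Quotient3_trunc])
qed

lemma lookup_mult_0:
  fixes f g :: "('n, 'k::comm_ring_1) mpol"
  shows "Poly_Mapping.lookup (f * g) 0 = Poly_Mapping.lookup f 0 * Poly_Mapping.lookup g 0"
proof (induction f rule: poly_mapping_induct_single)
  case (single k c)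
  show ?case
  proof (induction g rule: poly_mapping_induct_single)
    case (single l d)
    have "k + l = 0 \<longleftrightarrow> k = 0 \<and> l = 0"
      by (auto simp: poly_mapping_eq_iff fun_eq_iff lookup_add)
    then show ?case by (auto simp: mult_single lookup_single when_def)
  qed (simp_all add: distrib_left lookup_add)
qed (simp_all add: distrib_right lookup_add)

text \<open>The augmentation of the local ring; it descends because every element of the ideal has
  constant term 0. Applied to \<open>D (xvar i)\<close> it reads off the coefficient of
  \<open>partial i\<close> in the degree -1 part of \<open>D\<close>.\<close>

lift_definition const_term :: "('n::finite, 'k::field_prime_char) trunc \<Rightarrow> 'k" is
  "\<lambda>f. Poly_Mapping.lookup f 0"
proof -
  fix f g :: "('n, 'k) mpol"
  assume "f - g \<in> trunc_ideal"
  then obtain c where c: "f - g = (\<Sum>i\<in>UNIV. c i * Var i ^ CHAR('k))"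
    by (auto simp: trunc_ideal_def)
  have "Poly_Mapping.lookup (f - g) 0 = 0"
    unfolding c lookup_sum by (intro sum.neutral ballI lookup_0_mult_Var_power) simp
  then show "Poly_Mapping.lookup f 0 = Poly_Mapping.lookup g 0"
    by (simp add: lookup_minus)
qed

lemma const_term_0 [simp]: "const_term 0 = 0"
  and const_term_1 [simp]: "const_term 1 = 1"
  and const_term_add: "const_term (f + g) = const_term f + const_term g"
  and const_term_mult: "const_term (f * g) = const_term f * const_term g"
  and const_term_const [simp]: "const_term (trunc_const c) = c"
  by (transfer; simp add: lookup_one lookup_add lookup_mult_0 Const_def)+

lemma const_term_xvar [simp]: "const_term (xvar i) = 0"
  using lookup_0_mult_Var_power[of 1 1 i]
  by (simp add: const_term.abs_eq flip: abs_trunc_Var)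

lemma const_term_scale: "const_term (trunc_scale c f) = c * const_term f"
  by (simp add: trunc_scale_def const_term_mult)

lemma const_term_power: "const_term (f ^ m) = const_term f ^ m"
  by (induction m) (simp_all add: const_term_mult)

lemma const_term_prod: "const_term (\<Prod>i\<in>A. f i) = (\<Prod>i\<in>A. const_term (f i))"
  by (induction A rule: infinite_finite_induct) (simp_all add: const_term_mult)


subsection \<open>Derivations\<close>

lemma der_app_add: "der_app D (f + g) = der_app D f + der_app D g"
  and der_app_scale: "der_app D (trunc_scale c f) = trunc_scale c (der_app D f)"
  and der_app_mult: "der_app D (f * g) = der_app D f * g + f * der_app D g"
  using der_app[of D] by (auto simp: is_derivation_def)

lemma der_app_const [simp]: "der_app D (trunc_const c :: ('n::finite, 'k::field_prime_char) trunc) = 0"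
proof -
  have "der_app D 1 = 0" using der_app_mult[of D 1 1] by simp
  moreover have "trunc_const c = trunc_scale c (1 :: ('n, 'k) trunc)" by (simp add: trunc_scale_def)
  ultimately show ?thesis by (simp add: der_app_scale)
qed

lemma der_eqI_xvar:
  assumes "\<And>i. der_app D (xvar i) = der_app E (xvar i)"
  shows "D = E"
proof -
  have "der_app D f = der_app E f" for f
    by (induction f rule: trunc_induct) (simp_all add: assms der_app_add der_app_mult)
  then show ?thesis by (simp add: der_app_inject[symmetric] fun_eq_iff)
qed

text \<open>The formal partial derivative, given by its coefficients so that additivity is
  immediate. Its descent to the quotient is the witness for the definite description in
  \<open>partial\<close>.\<close>

lift_definition mpol_deriv :: "'n \<Rightarrow> ('n, 'k) mpol \<Rightarrow> ('n, 'k::comm_ring_1) mpol" is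
  "\<lambda>i f m. of_nat (Poly_Mapping.lookup m i + 1) * f (m + Poly_Mapping.single i 1)"
proof -
  fix i :: 'n and f :: "('n \<Rightarrow>\<^sub>0 nat) \<Rightarrow> 'k"
  assume "finite {m. f m \<noteq> 0}"
  then have "finite ((\<lambda>m. m + Poly_Mapping.single i 1) -` {m. f m \<noteq> 0})"
    by (rule finite_vimageI) (auto simp: inj_on_def)
  then show "finite {m. of_nat (Poly_Mapping.lookup m i + 1) * f (m + Poly_Mapping.single i 1) \<noteq> 0}"
    by (rule rev_finite_subset) auto
qed

lemma mpol_deriv_add: "mpol_deriv i (f + g) = mpol_deriv i f + mpol_deriv i g"
  by (rule poly_mapping_eqI) (simp add: mpol_deriv.rep_eq lookup_add algebra_simps)

lemma mpol_deriv_0 [simp]: "mpol_deriv i 0 = 0"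
  by (rule poly_mapping_eqI) (simp add: mpol_deriv.rep_eq)

lemma mpol_deriv_diff: "mpol_deriv i (f - g) = mpol_deriv i f - mpol_deriv i g"
  using mpol_deriv_add[of i "f - g" g] by (simp add: algebra_simps)

lemma mpol_deriv_single_0:
  assumes "Poly_Mapping.lookup m i = 0"
  shows "mpol_deriv i (Poly_Mapping.single m c) = 0"
proof (rule poly_mapping_eqI)
  fix k
  have "m \<noteq> k + Poly_Mapping.single i 1"
    using assms by (metis add_is_0 lookup_add lookup_single_eq zero_neq_one)
  then show "Poly_Mapping.lookup (mpol_deriv i (Poly_Mapping.single m c)) k
      = Poly_Mapping.lookup 0 k"
    by (simp add: mpol_deriv.rep_eq lookup_single)
qed

lemma mpol_deriv_single_Suc:
  "mpol_deriv i (Poly_Mapping.single (m + Poly_Mapping.single i 1) c) =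
     Poly_Mapping.single m (of_nat (Poly_Mapping.lookup m i + 1) * c)"
  by (rule poly_mapping_eqI) (simp add: mpol_deriv.rep_eq lookup_single when_def)

lemma exponent_cases:
  fixes m :: "'n \<Rightarrow>\<^sub>0 nat"
  obtains "Poly_Mapping.lookup m i = 0" | l where "m = l + Poly_Mapping.single i 1"
proof (cases "Poly_Mapping.lookup m i = 0")
  case False
  then have "m = (m - Poly_Mapping.single i 1) + Poly_Mapping.single i 1"
    by (intro poly_mapping_eqI) (auto simp: lookup_add lookup_minus lookup_single when_def)
  then show thesis using that by blast
qed (use that in blast)

text \<open>By biadditivity only monomials matter. The four cases record whether the
  \<open>i\<close>-th variable occurs in each factor, since lowering an exponent is possible only
  when it is positive.\<close>

lemma mpol_deriv_mult: "mpol_deriv i (f * g) = mpol_deriv i f * g + f * mpol_deriv i g"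
proof (induction f rule: poly_mapping_induct_single)
  case (single k c)
  show ?case
  proof (induction g rule: poly_mapping_induct_single)
    case (single l d)
    let ?s = "Poly_Mapping.single"
    have 1: "mpol_deriv i (?s k c * ?s (l + ?s i 1) d) =
        ?s (k + l) (of_nat (Poly_Mapping.lookup (k + l) i + 1) * (c * d))" for k l and c d :: 'b
      using mpol_deriv_single_Suc[of i "k + l" "c * d"] by (simp add: mult_single add.assoc)
    consider "Poly_Mapping.lookup k i = 0" "Poly_Mapping.lookup l i = 0"
      | l' where "Poly_Mapping.lookup k i = 0" "l = l' + ?s i 1"
      | k' where "k = k' + ?s i 1" "Poly_Mapping.lookup l i = 0"
      | k' l' where "k = k' + ?s i 1" "l = l' + ?s i 1"
      by (meson exponent_cases)
    then show ?case
    proof cases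
      case 1
      then show ?thesis by (simp add: mult_single mpol_deriv_single_0 lookup_add)
    next
      case 2
      then show ?thesis
        by (simp only: 1 mpol_deriv_single_0 mpol_deriv_single_Suc)
          (simp add: mult_single lookup_add mult_ac)
    next
      case 3
      have "mpol_deriv i (?s k c * ?s l d) =
          ?s (l + k') (of_nat (Poly_Mapping.lookup (l + k') i + 1) * (d * c))"
        unfolding 3 using 1[of l d k' c] by (simp add: mult.commute)
      then show ?thesis
        unfolding 3(1) mpol_deriv_single_Suc mpol_deriv_single_0[OF 3(2)]
        by (simp add: mult_single lookup_add mult_ac add_ac 3(2))
    next
      case 4
      show ?thesis
        unfolding 4 1 mpol_deriv_single_Suc
        by (simp add: mult_single lookup_add algebra_simps flip: single_add)
    qed
  qed (simp_all add: mpol_deriv_add algebra_simps)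
qed (simp_all add: mpol_deriv_add algebra_simps)

lemma mpol_deriv_sum: "mpol_deriv i (\<Sum>j\<in>A. f j) = (\<Sum>j\<in>A. mpol_deriv i (f j))"
  by (induction A rule: infinite_finite_induct) (simp_all add: mpol_deriv_add)

text \<open>The derivative carries the factor p = 0. With the Leibniz rule this makes the ideal
  stable under partial derivatives.\<close>

lemma mpol_deriv_Var_CHAR: "mpol_deriv i (Var j ^ CHAR('k) :: ('n, 'k::field_prime_char) mpol) = 0"
proof (cases "i = j")
  case True
  obtain q where q: "CHAR('k) = q + 1"
    using CHAR_pos[where ?'a = 'k] by (metis Suc_eq_plus1 gr0_implies_Suc)
  then have "of_nat (q + 1) = (0 :: 'k)" by (metis of_nat_CHAR)
  then have "mpol_deriv j (Poly_Mapping.single (Poly_Mapping.single j (q + 1)) 1 :: ('n, 'k) mpol) = 0"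
    using mpol_deriv_single_Suc[of j "Poly_Mapping.single j q" "1 :: 'k"]
    by (simp only: single_add lookup_single_eq mult_1_right single_zero)
  then show ?thesis by (simp only: Var_power True q)
qed (simp add: Var_power mpol_deriv_single_0 lookup_single)

lift_definition trunc_deriv :: "'n \<Rightarrow> ('n::finite, 'k::field_prime_char) trunc \<Rightarrow> ('n, 'k) trunc" is
  mpol_deriv
proof -
  fix i :: 'n and f g :: "('n, 'k) mpol"
  assume "f - g \<in> trunc_ideal"
  then obtain c where c: "f - g = (\<Sum>j\<in>UNIV. c j * Var j ^ CHAR('k))"
    by (auto simp: trunc_ideal_def)
  have "mpol_deriv i (f - g) = (\<Sum>j\<in>UNIV. mpol_deriv i (c j) * Var j ^ CHAR('k))"
    unfolding c by (simp add: mpol_deriv_sum mpol_deriv_mult mpol_deriv_Var_CHAR)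
  then show "mpol_deriv i f - mpol_deriv i g \<in> trunc_ideal"
    by (auto simp: trunc_ideal_def mpol_deriv_diff)
qed

lemma is_derivation_trunc_deriv:
  "is_derivation (trunc_deriv i :: ('n, 'k) trunc \<Rightarrow> ('n::finite, 'k::field_prime_char) trunc)"
proof -
  have "trunc_deriv i (f * g) = trunc_deriv i f * g + f * trunc_deriv i g" for f g :: "('n, 'k) trunc"
    by transfer (simp add: mpol_deriv_mult trunc_ideal_0)
  moreover have "trunc_deriv i (f + g) = trunc_deriv i f + trunc_deriv i g" for f g :: "('n, 'k) trunc"
    by transfer (simp add: mpol_deriv_add trunc_ideal_0)
  moreover have "trunc_deriv i (trunc_const c :: ('n, 'k) trunc) = 0" for c
    by transfer (simp add: Const_def mpol_deriv_single_0 trunc_ideal_0)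
  ultimately show ?thesis by (simp add: is_derivation_def trunc_scale_def)
qed

lemma trunc_deriv_xvar:
  "trunc_deriv i (xvar j) = (if i = j then 1 else 0 :: ('n::finite, 'k::field_prime_char) trunc)"
proof -
  have "mpol_deriv i (Var j) = (if i = j then 1 else 0 :: ('n, 'k) mpol)"
    using mpol_deriv_single_Suc[of j 0 1]
    by (auto simp: Var_def mpol_deriv_single_0 lookup_single)
  then show ?thesis
    by (simp add: trunc_deriv.abs_eq abs_trunc_1 abs_trunc_0 flip: abs_trunc_Var)
qed

text \<open>Existence comes from the formal derivative, uniqueness from the fact that a derivation
  is determined by its values on the generators.\<close>

lemma der_app_partial_xvar [simp]:
  "der_app (partial i) (xvar j) = (if i = j then 1 else 0 :: ('n::finite, 'k::field_prime_char) trunc)"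
proof -
  have "\<exists>!D :: ('n, 'k) der. \<forall>j. der_app D (xvar j) = (if i = j then 1 else 0)"
  proof (rule ex1I[of _ "Der (trunc_deriv i)"])
    show *: "\<forall>j. der_app (Der (trunc_deriv i) :: ('n, 'k) der) (xvar j) = (if i = j then 1 else 0)"
      by (simp add: Der_inverse is_derivation_trunc_deriv trunc_deriv_xvar)
    show "D = Der (trunc_deriv i)"
      if "\<forall>j. der_app D (xvar j) = (if i = j then 1 else 0)" for D :: "('n, 'k) der"
      using that * by (auto intro: der_eqI_xvar)
  qed
  from theI'[OF this] show ?thesis unfolding partial_def by blast
qed

lemma der_app_zero [simp]: "der_app 0 f = 0"
  and der_app_plus: "der_app (D + E) f = der_app D f + der_app E f"
  by (simp_all add: zero_der.rep_eq plus_der.rep_eq)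

lemma der_app_der_scale [simp]: "der_app (der_scale c D) f = trunc_scale c (der_app D f)"
  by (simp add: der_scale_def trunc_scale_def)

lemma der_app_sum: "der_app (\<Sum>i\<in>A. D i) f = (\<Sum>i\<in>A. der_app (D i) f)"
  by (induction A rule: infinite_finite_induct) (simp_all add: der_app_plus)

section \<open>Characteristic and Frobenius in the truncated ring\<close>

lemma prime_CHAR_field: "prime CHAR('k::field_prime_char)"
  by (rule prime_CHAR_semidom) simp

lemma trunc_const_0: "trunc_const 0 = 0"
  using trunc.scale_zero_left[of 1] by (simp add: trunc_scale_def)

lemma of_nat_trunc: "of_nat m = (trunc_const (of_nat m) :: ('n::finite, 'k::field_prime_char) trunc)"
  by (induction m) (simp_all add: trunc_const_0 trunc_const_add trunc_const_1)

lemma CHAR_trunc: "CHAR(('n::finite, 'k::field_prime_char) trunc) = CHAR('k)"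
proof (rule CHAR_eqI)
  show "of_nat CHAR('k) = (0 :: ('n, 'k) trunc)"
    by (simp add: of_nat_trunc trunc_const_0)
  fix m assume "of_nat m = (0 :: ('n, 'k) trunc)"
  then have "const_term (trunc_const (of_nat m) :: ('n, 'k) trunc) = 0"
    by (simp flip: of_nat_trunc)
  then show "CHAR('k) dvd m"
    by (simp add: of_nat_eq_0_iff_char_dvd)
qed

lemma xvar_power_CHAR: "(xvar i :: ('n::finite, 'k::field_prime_char) trunc) ^ CHAR('k) = 0"
proof -
  have "(\<Sum>j\<in>UNIV. (if j = i then 1 else 0) * Var j ^ CHAR('k) :: ('n, 'k) mpol) =
      (\<Sum>j\<in>UNIV. if j = i then Var i ^ CHAR('k) else 0)"
    by (rule sum.cong) auto
  also have "\<dots> = Var i ^ CHAR('k)" by simp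
  finally have "(Var i ^ CHAR('k) :: ('n, 'k) mpol) - 0 =
      (\<Sum>j\<in>UNIV. (if j = i then 1 else 0) * Var j ^ CHAR('k))"
    by (simp only: diff_0_right)
  then have "(Var i ^ CHAR('k) :: ('n, 'k) mpol) - 0 \<in> trunc_ideal"
    unfolding trunc_ideal_def by (intro CollectI exI)
  then have "abs_trunc (Var i ^ CHAR('k)) = (abs_trunc 0 :: ('n, 'k) trunc)"
    by (simp add: trunc.abs_eq_iff)
  then show ?thesis by (simp add: abs_trunc_power abs_trunc_Var abs_trunc_0)
qed

lemma one_plus_xvar_power_CHAR:
  "(1 + xvar i :: ('n::finite, 'k::field_prime_char) trunc) ^ CHAR('k) = 1"
proof -
  have "prime CHAR(('n, 'k) trunc)"
    unfolding CHAR_trunc by (rule prime_CHAR_field)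
  from freshmans_dream[OF this CHAR_trunc[symmetric], of 1 "xvar i"] show ?thesis
    by (simp add: xvar_power_CHAR)
qed


subsection \<open>A simultaneous eigenbasis of the torus\<close>

definition box :: "nat \<Rightarrow> ('n \<Rightarrow> nat) set" where
  "box p = {a. \<forall>i. a i < p}"

lemma finite_box [simp]: "finite (box p :: ('n::finite \<Rightarrow> nat) set)"
  using finite_set_of_finite_funs[of "UNIV :: 'n set" "{..<p}"]
  by (rule rev_finite_subset) (auto simp: box_def)

definition ymon :: "('n \<Rightarrow> nat) \<Rightarrow> ('n::finite, 'k::field_prime_char) trunc" where
  "ymon a = (\<Prod>i\<in>UNIV. (1 + xvar i) ^ a i)"

text \<open>The torus element with coordinates indexed by the variables themselves, so that sums run
  over \<open>UNIV\<close>; \<open>sum_toral_basis\<close> and \<open>toral_elt_tor\<close>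
  translate to the enumerated form.\<close>

definition tor :: "('n \<Rightarrow> 'k) \<Rightarrow> ('n::finite, 'k::field_prime_char) der" where
  "tor \<xi> = (\<Sum>i\<in>UNIV. der_scale (\<xi> i) (der_mult (1 + xvar i) (partial i)))"

lemma const_term_ymon [simp]: "const_term (ymon a) = 1"
  by (simp add: ymon_def const_term_prod const_term_power const_term_add)

lemma ymon_mod: "(ymon (\<lambda>i. a i mod CHAR('k)) :: ('n::finite, 'k::field_prime_char) trunc) = ymon a"
proof -
  have "(1 + xvar i :: ('n, 'k) trunc) ^ (m mod CHAR('k)) = (1 + xvar i) ^ m" for i m
  proof -
    have "(1 + xvar i :: ('n, 'k) trunc) ^ m =
        (1 + xvar i) ^ (CHAR('k) * (m div CHAR('k)) + m mod CHAR('k))"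
      by simp
    then show ?thesis by (simp only: power_add power_mult one_plus_xvar_power_CHAR) simp
  qed
  then show ?thesis by (simp add: ymon_def)
qed

lemma ymon_mult: "ymon a * ymon b = ymon (\<lambda>i. a i + b i)"
  by (simp add: ymon_def power_add prod.distrib)

text \<open>Since exponents only matter modulo p, the span is closed under multiplication. It
  contains the constants and \<open>xvar i\<close>, the difference of two such monomials, hence
  everything.\<close>

lemma span_ymon:
  "trunc.span (ymon ` box CHAR('k)) = (UNIV :: ('n::finite, 'k::field_prime_char) trunc set)"
proof -
  let ?V = "trunc.span (ymon ` box CHAR('k)) :: ('n, 'k) trunc set"
  have ymon: "ymon a \<in> ?V" for a
  proof -
    have "ymon (\<lambda>i. a i mod CHAR('k)) \<in> ?V"
      by (intro trunc.span_base imageI) (simp add: box_def)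
    then show ?thesis by (simp add: ymon_mod)
  qed
  have 1: "1 \<in> ?V" using ymon[of "\<lambda>_. 0"] by (simp add: ymon_def)
  have mult1: "ymon a * f \<in> ?V" if "f \<in> ?V" for a f
    using that
  proof (induction rule: trunc.span_induct_alt)
    case (step c f g)
    from step(1) obtain b where "f = ymon b" by blast
    then show ?case using step
      by (simp add: distrib_left trunc_scale_times ymon_mult trunc.span_add trunc.span_scale ymon)
  qed (simp add: trunc.span_zero)
  have mult: "g * f \<in> ?V" if "g \<in> ?V" "f \<in> ?V" for g f
    using that(1)
  proof (induction rule: trunc.span_induct_alt)
    case (step c h g)
    then show ?case using that(2)
      by (auto simp: distrib_right trunc_scale_times trunc.span_add trunc.span_scale mult1)
  qed (simp add: trunc.span_zero)
  have "f \<in> ?V" for f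
  proof (induction f rule: trunc_induct)
    case (const c)
    have "trunc_scale c 1 = (trunc_const c :: ('n, 'k) trunc)" by (simp add: trunc_scale_def)
    then show ?case using trunc.span_scale[OF 1, of c] by metis
  next
    case (var i)
    \<comment> \<open>The unit exponent vector gives the monomial \<open>1 + xvar i\<close>.\<close>
    have "ymon (\<lambda>j. if i = j then 1 else 0) = (\<Prod>j\<in>{i}. 1 + xvar j :: ('n, 'k) trunc)"
      unfolding ymon_def by (rule prod.mono_neutral_cong_right) auto
    then have "1 + xvar i \<in> ?V" using ymon[of "\<lambda>j. if i = j then 1 else 0"] by simp
    from trunc.span_diff[OF this 1] show ?case by simp
  qed (auto intro: mult trunc.span_add)
  then show ?thesis by blast
qed

lemma tor_one_plus_xvar: "der_app (tor \<xi>) (1 + xvar i) = trunc_scale (\<xi> i) (1 + xvar i)"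
proof -
  have "der_app D (1 + xvar i) = der_app D (xvar i)" for D :: "('a, 'b) der"
    using der_app_const[of D 1] by (simp add: der_app_add trunc_const_1)
  then have "der_app (tor \<xi>) (1 + xvar i) =
      (\<Sum>j\<in>UNIV. trunc_scale (\<xi> j) ((1 + xvar j) * (if j = i then 1 else 0)))"
    by (simp add: tor_def der_app_sum)
  also have "\<dots> = (\<Sum>j\<in>UNIV. if j = i then trunc_scale (\<xi> i) (1 + xvar i) else 0)"
    by (rule sum.cong) auto
  finally show ?thesis by simp
qed

text \<open>By the Leibniz rule the eigenvalues of eigenvectors add under multiplication.\<close>

lemma tor_ymon:
  "der_app (tor \<xi>) (ymon a) = trunc_scale (\<Sum>i\<in>UNIV. of_nat (a i) * \<xi> i) (ymon a)"
proof -
  let ?D = "der_app (tor \<xi>)"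
  have mult: "?D (f * g) = trunc_scale (c + d) (f * g)"
    if "?D f = trunc_scale c f" "?D g = trunc_scale d g" for f g c d
    using that by (simp add: der_app_mult trunc_scale_times trunc.scale_left_distrib)
  have 1: "?D 1 = trunc_scale 0 1"
    using der_app_const[of "tor \<xi>" 1] by (simp add: trunc_const_1)
  have power: "?D ((1 + xvar i) ^ m) = trunc_scale (of_nat m * \<xi> i) ((1 + xvar i) ^ m)" for i m
  proof (induction m)
    case (Suc m)
    from mult[OF tor_one_plus_xvar Suc] show ?case by (simp add: algebra_simps)
  qed (simp add: 1)
  have "?D (\<Prod>i\<in>A. (1 + xvar i) ^ a i) =
      trunc_scale (\<Sum>i\<in>A. of_nat (a i) * \<xi> i) (\<Prod>i\<in>A. (1 + xvar i) ^ a i)" for A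
    by (induction A rule: infinite_finite_induct) (use 1 in \<open>simp_all add: mult power\<close>)
  then show ?thesis by (simp add: ymon_def)
qed

lemma linear_der_app: "Vector_Spaces.linear trunc_scale trunc_scale (der_app D)"
  by unfold_locales (simp_all add: der_app_add der_app_scale)

lemma of_nat_inj_less_CHAR:
  assumes "a < CHAR('k)" "b < CHAR('k)" "of_nat a = (of_nat b :: 'k::field_prime_char)"
  shows "a = b"
proof -
  have *: "a = b" if "a \<le> b" "b < CHAR('k)" "of_nat a = (of_nat b :: 'k)" for a b
  proof -
    have "of_nat (b - a) = (0 :: 'k)" using that by (simp add: of_nat_diff)
    then have "CHAR('k) dvd b - a" by (simp add: of_nat_eq_0_iff_char_dvd)
    then show ?thesis using that by (metis diff_is_0_eq dvd_imp_le le_antisym less_imp_diff_less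
      linorder_not_less not_gr_zero)
  qed
  show ?thesis using *[of a b] *[of b a] assms by (cases "a \<le> b") auto
qed

text \<open>Independence of joint eigenvectors. Distinct exponents \<open>a\<close>,
  \<open>b\<close> in the box differ at some \<open>j\<close>, and \<open>a j\<close>,
  \<open>b j\<close> stay distinct in the prime field; the operator below removes the term of
  \<open>b\<close> and multiplies the coefficient of \<open>a\<close> by a nonzero scalar, so the
  shorter relation applies. A one-term relation is impossible because \<open>ymon a\<close> has
  constant term 1.\<close>

lemma ymon_lin_indep:
  fixes c :: "('n::finite \<Rightarrow> nat) \<Rightarrow> 'k::field_prime_char"
  assumes "finite S" "S \<subseteq> box CHAR('k)"
    "(\<Sum>a\<in>S. trunc_scale (c a) (ymon a)) = (0 :: ('n, 'k) trunc)" "a \<in> S"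
  shows "c a = 0"
  using assms
proof (induction "card S" arbitrary: S c a)
  case (Suc m S c a)
  have others: "c a = 0" if ab: "a \<in> S" "b \<in> S" "a \<noteq> b" for a b
  proof -
    from ab obtain j where j: "a j \<noteq> b j" by auto
    \<comment> \<open>apply the derivation with eigenvalue \<open>a j\<close> on \<open>ymon a\<close>, minus the scalar \<open>b j\<close>\<close>
    let ?\<xi> = "\<lambda>i. if i = j then 1 else 0 :: 'k"
    have eig: "der_app (tor ?\<xi>) (ymon d) = trunc_scale (of_nat (d j)) (ymon d)" for d
    proof -
      have "(\<Sum>i\<in>UNIV. of_nat (d i) * ?\<xi> i) = (\<Sum>i\<in>UNIV. if i = j then of_nat (d j) else 0)"
        by (rule sum.cong) auto
      then show ?thesis by (simp add: tor_ymon)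
    qed
    interpret D: Vector_Spaces.linear trunc_scale trunc_scale "der_app (tor ?\<xi>)"
      by (rule linear_der_app)
    let ?w = "\<Sum>a\<in>S. trunc_scale (c a) (ymon a) :: ('n, 'k) trunc"
    let ?c = "\<lambda>a. (of_nat (a j) - of_nat (b j)) * c a"
    have "0 = der_app (tor ?\<xi>) ?w - trunc_scale (of_nat (b j)) ?w"
      unfolding Suc.prems(3) by (simp add: D.zero)
    also have "\<dots> = (\<Sum>a\<in>S. trunc_scale (?c a) (ymon a))"
      by (simp add: D.sum D.scale eig trunc.scale_sum_right mult.commute
          flip: sum_subtractf trunc.scale_left_diff_distrib right_diff_distrib)
    also have "\<dots> = (\<Sum>a\<in>S - {b}. trunc_scale (?c a) (ymon a))"
      using Suc.prems(1) by (intro sum.mono_neutral_right) auto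
    finally have "?c a = 0"
      using Suc.prems ab Suc.hyps(2) by (intro Suc.hyps(1)[of "S - {b}" ?c]) auto
    moreover have "of_nat (a j) \<noteq> (of_nat (b j) :: 'k)"
      using j of_nat_inj_less_CHAR[where ?'k = 'k, of "a j" "b j"] ab Suc.prems(2)
      by (auto simp: box_def)
    ultimately show ?thesis by simp
  qed
  show "c a = 0"
  proof (cases "S = {a}")
    case True
    with Suc.prems(3) have "(\<Sum>a\<in>{a}. trunc_scale (c a) (ymon a)) = (0 :: ('n, 'k) trunc)" by metis
    from arg_cong[OF this, of const_term] show ?thesis by (simp add: const_term_scale)
  next
    case False
    with Suc.prems obtain b where "b \<in> S" "b \<noteq> a" by blast
    then show ?thesis using others[of a b] Suc.prems by auto
  qed
qed simp

lemma inj_on_ymon: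
  "inj_on (ymon :: _ \<Rightarrow> ('n::finite, 'k::field_prime_char) trunc) (box CHAR('k))"
proof (rule inj_onI)
  fix a b :: "'n \<Rightarrow> nat"
  assume ab: "a \<in> box CHAR('k)" "b \<in> box CHAR('k)" "ymon a = (ymon b :: ('n, 'k) trunc)"
  show "a = b"
  proof (rule ccontr)
    assume ne: "a \<noteq> b"
    then have "(\<Sum>d\<in>{a, b}. trunc_scale (if d = a then 1 else - 1) (ymon d)) = (0 :: ('n, 'k) trunc)"
      using ab by simp
    then have "(if a = a then 1 else - 1) = (0 :: 'k)"
      using ab by (intro ymon_lin_indep[of "{a, b}" "\<lambda>d. if d = a then 1 else - 1" a]) auto
    then show False by simp
  qed
qed

lemma independent_ymon:
  "trunc.independent (ymon ` box CHAR('k) :: ('n::finite, 'k::field_prime_char) trunc set)"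
proof -
  let ?B = "box CHAR('k) :: ('n \<Rightarrow> nat) set"
  have "u v = 0" if u: "(\<Sum>v\<in>ymon ` ?B. trunc_scale (u v) v) = 0" and v: "v \<in> ymon ` ?B"
    for u and v :: "('n, 'k) trunc"
  proof -
    from v obtain a where a: "a \<in> ?B" "v = ymon a" by blast
    have "(\<Sum>a\<in>?B. trunc_scale (u (ymon a)) (ymon a)) = 0"
      using u by (simp add: sum.reindex[OF inj_on_ymon])
    from ymon_lin_indep[OF _ _ this a(1)] a(2) show ?thesis by simp
  qed
  moreover have "finite (ymon ` ?B :: ('n, 'k) trunc set)" by simp
  ultimately show ?thesis unfolding trunc.dependent_finite[OF \<open>finite (ymon ` ?B)\<close>] by blast
qed

lemma trunc_basis_ymon:
  obtains as where "distinct as" "set as = box CHAR('k)"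
    "trunc_basis (map ymon as :: ('n::finite, 'k::field_prime_char) trunc list)"
proof -
  obtain as :: "('n \<Rightarrow> nat) list" where as: "set as = box CHAR('k)" "distinct as"
    using finite_distinct_list[OF finite_box] by blast
  moreover have "trunc_basis (map ymon as :: ('n, 'k) trunc list)"
    using as inj_on_ymon[where ?'n = 'n and ?'k = 'k] independent_ymon span_ymon
    by (simp add: trunc_basis_def distinct_map)
  ultimately show thesis using that by blast
qed


subsection \<open>Powers of toral elements\<close>

lemma linear_funpow_der_app: "Vector_Spaces.linear trunc_scale trunc_scale (der_app D ^^ m)"
proof (induction m)
  case 0
  show ?case using trunc.linear_id by (simp add: id_def)
next
  case (Suc m)
  then show ?case using Vector_Spaces.linear_compose[OF Suc linear_der_app] by (simp add: o_def)
qed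

lemma funpow_tor_ymon:
  "(der_app (tor \<xi>) ^^ m) (ymon a) = trunc_scale ((\<Sum>i\<in>UNIV. of_nat (a i) * \<xi> i) ^ m) (ymon a)"
  by (induction m) (simp_all add: der_app_scale tor_ymon mult.commute)

lemma power_CHAR_of_nat: "(of_nat m :: 'k::field_prime_char) ^ (CHAR('k) ^ k) = of_nat m"
proof (induction m)
  case (Suc m)
  then show ?case
    using freshmans_dream'[OF prime_CHAR_field refl, where x = "1 :: 'k" and y = "of_nat m" and n = k]
    by simp
qed simp

lemma power_CHAR_lincomb:
  fixes \<xi> :: "'i \<Rightarrow> 'k::field_prime_char"
  shows "(\<Sum>i\<in>A. of_nat (a i) * \<xi> i) ^ (CHAR('k) ^ k) = (\<Sum>i\<in>A. of_nat (a i) * \<xi> i ^ (CHAR('k) ^ k))"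
  by (subst freshmans_dream_sum'[OF prime_CHAR_field refl])
    (simp add: power_mult_distrib power_CHAR_of_nat)

text \<open>Both sides are linear, so it suffices to compare eigenvalues on the
  \<open>ymon a\<close>: Frobenius is additive and fixes the integers \<open>a i\<close>.\<close>

lemma der_power_tor:
  "der_power (tor \<xi>) (CHAR('k) ^ k) =
     (tor (\<lambda>i. \<xi> i ^ (CHAR('k) ^ k)) :: ('n::finite, 'k::field_prime_char) der)"
proof -
  let ?E = "tor (\<lambda>i. \<xi> i ^ (CHAR('k) ^ k)) :: ('n, 'k) der"
  interpret vector_space_pair "trunc_scale :: 'k \<Rightarrow> ('n, 'k) trunc \<Rightarrow> _" trunc_scale ..
  have "(der_app (tor \<xi>) ^^ (CHAR('k) ^ k)) f = der_app ?E f" for f :: "('n, 'k) trunc"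
  proof (rule linear_eq_on[OF linear_funpow_der_app linear_der_app])
    show "f \<in> trunc.span (ymon ` box CHAR('k))" by (simp add: span_ymon)
  qed (auto simp: funpow_tor_ymon tor_ymon power_CHAR_lincomb)
  then have "der_app (tor \<xi>) ^^ (CHAR('k) ^ k) = der_app ?E" by blast
  \<comment> \<open>\<open>Der\<close> is meaningful on this iterate because it coincides with
    \<open>der_app ?E\<close>.\<close>
  then show ?thesis by (simp add: der_power_def der_app_inverse)
qed


subsection \<open>Characteristic polynomials of toral elements\<close>

text \<open>The matrix of \<open>F\<close> with independent bases for source and target: equal bases
  give \<open>trunc_matrix\<close>, and \<open>F = id\<close> gives the transition matrices.\<close>

definition change_matrix ::
    "('n, 'k) trunc list \<Rightarrow> ('n, 'k) trunc list \<Rightarrow>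
     (('n, 'k) trunc \<Rightarrow> ('n::finite, 'k::field_prime_char) trunc) \<Rightarrow> 'k mat" where
  "change_matrix bs cs F = mat (length cs) (length bs)
     (\<lambda>(r, s). trunc.representation (set cs) (F (bs ! s)) (cs ! r))"

lemma change_matrix_compose:
  fixes bs cs ds :: "('n::finite, 'k::field_prime_char) trunc list"
  assumes cs: "trunc_basis cs" and ds: "trunc_basis ds"
    and G: "Vector_Spaces.linear trunc_scale trunc_scale G"
  shows "change_matrix bs ds (G \<circ> F) = change_matrix cs ds G * change_matrix bs cs F"
proof (rule eq_matI)
  fix r s
  assume "r < dim_row (change_matrix cs ds G * change_matrix bs cs F)"
    "s < dim_col (change_matrix cs ds G * change_matrix bs cs F)"
  then have rs: "r < length ds" "s < length bs" by (simp_all add: change_matrix_def)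
  interpret G: Vector_Spaces.linear trunc_scale trunc_scale G by fact
  let ?v = "F (bs ! s)"
  let ?R = "trunc.representation (set cs) ?v"
  have ics: "trunc.independent (set cs)" "distinct cs" "trunc.span (set cs) = UNIV"
    and ids: "trunc.independent (set ds)" "trunc.span (set ds) = UNIV"
    using cs ds by (auto simp: trunc_basis_def)
  have "?v = (\<Sum>b\<in>set cs. trunc_scale (?R b) b)"
    using ics by (intro trunc.sum_representation_eq[symmetric]) auto
  also have "\<dots> = (\<Sum>q<length cs. trunc_scale (?R (cs ! q)) (cs ! q))"
    using ics(2) by (intro sum.reindex_bij_betw[symmetric] bij_betw_nth) auto
  finally have "G ?v = (\<Sum>q<length cs. trunc_scale (?R (cs ! q)) (G (cs ! q)))"
    by (metis (no_types, lifting) G.sum G.scale sum.cong)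
  then have "trunc.representation (set ds) (G ?v) =
      (\<lambda>b. \<Sum>q<length cs. ?R (cs ! q) * trunc.representation (set ds) (G (cs ! q)) b)"
    using ids by (simp add: trunc.representation_sum trunc.representation_scale)
  then show "change_matrix bs ds (G \<circ> F) $$ (r, s) =
      (change_matrix cs ds G * change_matrix bs cs F) $$ (r, s)"
    using rs by (simp add: change_matrix_def scalar_prod_def mult.commute atLeast0LessThan)
qed (simp_all add: change_matrix_def)

lemma change_matrix_id:
  fixes bs :: "('n::finite, 'k::field_prime_char) trunc list"
  assumes "trunc_basis bs"
  shows "change_matrix bs bs id = 1\<^sub>m (length bs)"
  using assms
  by (intro eq_matI) (auto simp: change_matrix_def trunc_basis_def trunc.representation_basis
      nth_eq_iff_index_eq)

lemma trunc_basis_length: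
  fixes bs cs :: "('n::finite, 'k::field_prime_char) trunc list"
  assumes "trunc_basis bs" "trunc_basis cs"
  shows "length bs = length cs"
proof -
  have "trunc.dim (UNIV :: ('n, 'k) trunc set) = length bs"
    if "trunc_basis bs" for bs :: "('n, 'k) trunc list"
    using that trunc.dim_eq_card[of "set bs" UNIV]
    by (auto simp: trunc_basis_def distinct_card)
  then show ?thesis using assms by metis
qed

text \<open>The transition matrices of the two bases are mutually inverse and conjugate one matrix
  into the other. This frees \<open>trunc_char_poly\<close> from the basis chosen by
  \<open>SOME\<close> and permits computation in the eigenbasis.\<close>

lemma char_poly_trunc_matrix:
  fixes bs cs :: "('n::finite, 'k::field_prime_char) trunc list"
  assumes bs: "trunc_basis bs" and cs: "trunc_basis cs"
    and F: "Vector_Spaces.linear trunc_scale trunc_scale F"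
  shows "char_poly (trunc_matrix bs F) = char_poly (trunc_matrix cs F)"
proof -
  have len: "length cs = length bs" by (rule trunc_basis_length[OF cs bs])
  have id: "Vector_Spaces.linear trunc_scale trunc_scale (id :: ('n, 'k) trunc \<Rightarrow> _)"
    by (simp add: trunc.linear_id)
  let ?P = "change_matrix cs bs id" and ?Q = "change_matrix bs cs id"
  have "similar_mat (trunc_matrix bs F) (trunc_matrix cs F)"
  proof (rule similar_matI[of _ _ ?P ?Q "length bs"])
    show "?P * ?Q = 1\<^sub>m (length bs)"
      using change_matrix_compose[OF cs bs id, of bs id] change_matrix_id[OF bs] by simp
    show "?Q * ?P = 1\<^sub>m (length bs)"
      using change_matrix_compose[OF bs cs id, of cs id] change_matrix_id[OF cs] len by simp
    have "trunc_matrix bs F = change_matrix bs bs (id \<circ> (F \<circ> id))"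
      by (simp add: trunc_matrix_def change_matrix_def)
    also have "\<dots> = ?P * (change_matrix cs cs F * ?Q)"
      by (simp only: change_matrix_compose[OF cs bs id] change_matrix_compose[OF cs cs F])
    also have "\<dots> = ?P * change_matrix cs cs F * ?Q"
      by (rule assoc_mult_mat[symmetric]) (auto simp: change_matrix_def)
    finally show "trunc_matrix bs F = ?P * trunc_matrix cs F * ?Q"
      by (simp add: trunc_matrix_def change_matrix_def)
  qed (auto simp: trunc_matrix_def change_matrix_def len)
  then show ?thesis by (rule char_poly_similar)
qed

lemma trunc_char_poly_tor:
  "trunc_char_poly (der_app (tor \<xi> :: ('n::finite, 'k::field_prime_char) der)) =
     (\<Prod>a\<in>box CHAR('k). [:- (\<Sum>i\<in>UNIV. of_nat (a i) * \<xi> i), 1:])"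
proof -
  let ?F = "der_app (tor \<xi> :: ('n, 'k) der)" and ?e = "\<lambda>a. \<Sum>i\<in>UNIV. of_nat (a i) * \<xi> i"
  obtain as :: "('n \<Rightarrow> nat) list" where as: "distinct as" "set as = box CHAR('k)"
    and bas: "trunc_basis (map ymon as :: ('n, 'k) trunc list)"
    by (rule trunc_basis_ymon)
  let ?ys = "map ymon as :: ('n, 'k) trunc list"
  let ?A = "trunc_matrix ?ys ?F"
  have A: "?A \<in> carrier_mat (length as) (length as)" by (simp add: trunc_matrix_def)
  have entry: "?A $$ (r, s) = (if r = s then ?e (as ! s) else 0)"
    if "r < length as" "s < length as" for r s
  proof -
    have "trunc.independent (set ?ys)" "distinct ?ys" "ymon (as ! s) \<in> set ?ys"
      using bas that unfolding trunc_basis_def by auto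
    then have "trunc.representation (set ?ys) (?F (ymon (as ! s))) (ymon (as ! r)) =
        ?e (as ! s) * (if ymon (as ! r) = (ymon (as ! s) :: ('n, 'k) trunc) then 1 else 0)"
      unfolding tor_ymon
      by (subst trunc.representation_scale)
        (auto simp: trunc.span_base trunc.representation_basis simp del: set_map)
    moreover have "ymon (as ! r) = (ymon (as ! s) :: ('n, 'k) trunc) \<longleftrightarrow> r = s"
      using nth_eq_iff_index_eq[OF \<open>distinct ?ys\<close>, of r s] that by simp
    ultimately show ?thesis using that by (simp add: trunc_matrix_def)
  qed
  have "trunc_char_poly ?F = char_poly ?A"
    unfolding trunc_char_poly_def
    \<comment> \<open>The eigenbasis enters twice: as evidence that the chosen list is a basis, and
      as the basis in which the polynomial is computed.\<close>
    by (rule char_poly_trunc_matrix[OF someI[of trunc_basis] _ linear_der_app]) (rule bas)+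
  also have "\<dots> = (\<Prod>a\<leftarrow>diag_mat ?A. [:- a, 1:])"
    by (rule char_poly_upper_triangular[OF A]) (use A entry in \<open>auto simp: upper_triangular_def\<close>)
  also have "diag_mat ?A = map (\<lambda>r. ?e (as ! r)) [0..<length as]"
    using A entry by (auto simp: diag_mat_def)
  also have "\<dots> = map ?e as"
    by (rule nth_equalityI) auto
  also have "(\<Prod>a\<leftarrow>map ?e as. [:- a, 1:]) = (\<Prod>a\<in>set as. [:- ?e a, 1:])"
    using as(1) by (simp add: prod.distinct_set_conv_list o_def)
  finally show ?thesis by (simp add: as)
qed


subsection \<open>The exterior algebra\<close>

text \<open>Expand along row \<open>k\<close>: its cofactors do not involve that row, so the three
  matrices share them.\<close>

lemma det_row_linear:
  fixes X Y Z :: "'k::comm_ring_1 mat"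
  assumes X: "X \<in> carrier_mat n n" and Y: "Y \<in> carrier_mat n n" and Z: "Z \<in> carrier_mat n n"
    and k: "k < n"
    and off: "\<And>i j. i < n \<Longrightarrow> j < n \<Longrightarrow> i \<noteq> k \<Longrightarrow> X $$ (i, j) = Y $$ (i, j) \<and> Z $$ (i, j) = Y $$ (i, j)"
    and row: "\<And>j. j < n \<Longrightarrow> X $$ (k, j) = c * Y $$ (k, j) + d * Z $$ (k, j)"
  shows "det X = c * det Y + d * det Z"
proof -
  have "mat_delete X k j = mat_delete Y k j" "mat_delete Z k j = mat_delete Y k j" for j
    using X Y Z off by (auto simp: mat_delete_def intro!: eq_matI)
  then have cof: "cofactor X k j = cofactor Y k j" "cofactor Z k j = cofactor Y k j" for j
    by (simp_all add: cofactor_def)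
  show ?thesis
    by (simp add: laplace_expansion_row[OF X k] laplace_expansion_row[OF Y k]
        laplace_expansion_row[OF Z k] row cof sum_distrib_left sum.distrib algebra_simps)
qed

text \<open>The determinant of the degree -1 parts in the basis of the coordinate derivations. The
  value 0 on lists of other lengths extends it to the whole exterior algebra.\<close>

definition wedge_det :: "('n::{finite,linorder}, 'k::field_prime_char) der list \<Rightarrow> 'k" where
  "wedge_det ds = (if length ds = CARD('n)
     then det (mat CARD('n) CARD('n) (\<lambda>(r, s). const_term (der_app (ds ! r) (xvar (idx s)))))
     else 0)"

text \<open>One form for three uses: additivity (\<open>c = d = 1\<close>), homogeneity
  (\<open>d = 0\<close>), and vanishing when a row is zero (\<open>c = d = 0\<close>).\<close>

lemma wedge_det_linear:
  fixes D E F :: "('n::{finite,linorder}, 'k::field_prime_char) der"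
  assumes "\<And>i. const_term (der_app F (xvar i)) =
      c * const_term (der_app D (xvar i)) + d * const_term (der_app E (xvar i))"
  shows "wedge_det (as @ F # bs) = c * wedge_det (as @ D # bs) + d * wedge_det (as @ E # bs)"
proof (cases "length as + length bs + 1 = CARD('n)")
  case True
  show ?thesis
    unfolding wedge_det_def using True
    by (simp, intro det_row_linear[where k = "length as"]) (auto simp: nth_append assms)
qed (simp add: wedge_det_def)

lemma wedge_det_not_distinct: "\<not> distinct ds \<Longrightarrow> wedge_det ds = 0"
proof -
  assume "\<not> distinct ds"
  then obtain i j where "i < length ds" "j < length ds" "i \<noteq> j" "ds ! i = ds ! j"
    by (auto simp: distinct_conv_nth)
  then show ?thesis
    unfolding wedge_det_def
    by (auto intro!: det_identical_rows[of _ "CARD('a)" i j] eq_vecI)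
qed

lift_definition wedge_coeff :: "('n::{finite,linorder}, 'k::field_prime_char) ext \<Rightarrow> 'k" is
  "pm_lin wedge_det"
proof -
  fix u v :: "('n, 'k) der list \<Rightarrow>\<^sub>0 'k"
  assume "u - v \<in> ext_relations"
  then have "pm_lin wedge_det (u - v) = 0"
    unfolding ext_relations_def
  proof (induction rule: free.span_induct_alt)
    case (step c x y)
    have "wedge_det (as @ [D + E] @ bs) = wedge_det (as @ [D] @ bs) + wedge_det (as @ [E] @ bs)"
      for as bs and D E :: "('n, 'k) der"
      using wedge_det_linear[of "D + E" 1 D 1 E] by (simp add: der_app_plus const_term_add)
    moreover have "wedge_det (as @ [der_scale a D] @ bs) = a * wedge_det (as @ [D] @ bs)"
      for as bs a and D :: "('n, 'k) der"
      using wedge_det_linear[of "der_scale a D" a D 0 D] by (simp add: const_term_scale)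
    ultimately have "pm_lin wedge_det x = 0"
      using step(1) by (auto simp: pm_lin_diff pm_lin_free_scale wedge_det_not_distinct)
    then show ?case using step(2) by (simp add: pm_lin_add pm_lin_free_scale)
  qed simp
  then show "pm_lin wedge_det u = pm_lin wedge_det v" by (simp add: pm_lin_diff)
qed

lemma wedge_coeff_0 [simp]: "wedge_coeff 0 = 0"
  and wedge_coeff_add: "wedge_coeff (u + v) = wedge_coeff u + wedge_coeff v"
  and wedge_coeff_scale: "wedge_coeff (ext_scale c u) = c * wedge_coeff u"
  by (transfer; simp add: pm_lin_add pm_lin_free_scale)+

lemma wedge_coeff_wedge: "wedge_coeff (wedge ds) = wedge_det ds"
  by (simp add: wedge_def wedge_coeff.abs_eq)

section \<open>Multilinear and alternating calculus of wedges\<close>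

lemma abs_ext_eqI: "u - v \<in> ext_relations \<Longrightarrow> abs_ext u = abs_ext v"
  by (simp add: ext.abs_eq_iff)

lemma wedge_add: "wedge (as @ (D + E) # bs) = wedge (as @ D # bs) + wedge (as @ E # bs)"
proof -
  have "gen (as @ [D + E] @ bs) - gen (as @ [D] @ bs) - gen (as @ [E] @ bs) \<in> ext_relations"
    unfolding ext_relations_def by (rule free.span_base) blast
  then show ?thesis
    unfolding wedge_def plus_ext.abs_eq by (intro abs_ext_eqI) (simp add: algebra_simps)
qed

lemma wedge_scale: "wedge (as @ der_scale c D # bs) = ext_scale c (wedge (as @ D # bs))"
proof -
  have "gen (as @ [der_scale c D] @ bs) - free_scale c (gen (as @ [D] @ bs)) \<in> ext_relations"
    unfolding ext_relations_def by (rule free.span_base) blast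
  then show ?thesis
    unfolding wedge_def ext_scale.abs_eq by (intro abs_ext_eqI) simp
qed

lemma wedge_not_distinct:
  assumes "\<not> distinct ds"
  shows "wedge ds = 0"
proof -
  have "gen ds \<in> ext_relations"
    unfolding ext_relations_def by (rule free.span_base) (use assms in blast)
  then show ?thesis
    unfolding wedge_def zero_ext_def by (intro abs_ext_eqI) simp
qed

lemma wedge_zero [simp]: "wedge (as @ 0 # bs) = 0"
  using wedge_scale[of as 0 0 bs] by simp

text \<open>Polarisation: expand the wedge in which \<open>D + E\<close> is repeated.\<close>

lemma wedge_swap: "wedge (as @ D # E # bs) = - wedge (as @ E # D # bs)"
proof -
  have alt: "wedge (as @ F # F # bs) = 0" for F
    by (rule wedge_not_distinct) simp
  have "0 = wedge (as @ (D + E) # (D + E) # bs)"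
    by (simp only: alt)
  also have "\<dots> = wedge (as @ D # E # bs) + wedge (as @ E # D # bs)"
    using wedge_add[of "as @ [D]" D E bs] wedge_add[of "as @ [E]" D E bs]
    by (simp add: wedge_add alt)
  finally show ?thesis by (simp add: eq_neg_iff_add_eq_0)
qed

lemma wedge_move: "\<exists>c. wedge (as @ D # xs @ bs) = ext_scale c (wedge (as @ xs @ D # bs))"
proof (induction xs arbitrary: as)
  case Nil
  show ?case by (intro exI[of _ 1]) simp
next
  case (Cons x xs)
  from Cons[of "as @ [x]"] obtain c where
    "wedge (as @ x # D # xs @ bs) = ext_scale c (wedge (as @ x # xs @ D # bs))" by auto
  then have "wedge (as @ D # (x # xs) @ bs) = ext_scale (- c) (wedge (as @ (x # xs) @ D # bs))"
    using wedge_swap[of as D x "xs @ bs"] by simp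
  then show ?case by blast
qed

text \<open>The scalar is a sign, but only its existence is recorded: the target is membership in a
  span.\<close>

lemma wedge_perm: "mset xs = mset ys \<Longrightarrow> \<exists>c. wedge (as @ xs) = ext_scale c (wedge (as @ ys))"
proof (induction xs arbitrary: as ys)
  case Nil
  then show ?case by (intro exI[of _ 1]) simp
next
  case (Cons x xs)
  then have "x \<in> set ys" by (metis list.set_intros(1) set_mset_mset)
  then obtain ys1 ys2 where ys: "ys = ys1 @ x # ys2" by (meson split_list)
  obtain c where "wedge ((as @ [x]) @ xs) = ext_scale c (wedge ((as @ [x]) @ ys1 @ ys2))"
    using Cons.IH[of "ys1 @ ys2" "as @ [x]"] Cons.prems ys by auto
  moreover obtain d where "wedge (as @ x # ys1 @ ys2) = ext_scale d (wedge (as @ ys1 @ x # ys2))"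
    using wedge_move by blast
  ultimately show ?case unfolding ys by auto
qed

abbreviation partials :: "('n::{finite,linorder}, 'k::field_prime_char) der list" where
  "partials \<equiv> map (\<lambda>j. partial (idx j)) [0..<CARD('n)]"

lemma set_partials: "set (partials :: ('n::{finite,linorder}, 'k::field_prime_char) der list) = range partial"
  using bij_betw_idx[where ?'n = 'n] by (auto simp: bij_betw_def atLeast0LessThan image_image[symmetric])

text \<open>The prefix \<open>as\<close> collects factors already replaced by coordinate
  derivations; multilinearity moves the factors of \<open>bs\<close> there one by one. At the end
  the list either repeats an entry or permutes all coordinate derivations.\<close>

lemma wedge_partials_span:
  fixes as bs :: "('n::{finite,linorder}, 'k::field_prime_char) der list"
  assumes "set as \<subseteq> range partial" "set bs \<subseteq> der.span (range partial)"
    "length as + length bs = CARD('n)"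
  shows "wedge (as @ bs) \<in> ext.span {wedge partials}"
  using assms
proof (induction bs arbitrary: as)
  case Nil
  show ?case
  proof (cases "distinct as")
    case True
    let ?P = "partials :: ('n, 'k) der list"
    \<comment> \<open>Counting: \<open>n\<close> distinct entries inside the set of a list of length
      \<open>n\<close> force that list to be distinct and to have the same entries.\<close>
    have "card (set as) \<le> card (set ?P)"
      using Nil by (intro card_mono) (simp_all add: set_partials del: set_map)
    moreover have "card (set as) = length ?P" using True Nil by (simp add: distinct_card)
    ultimately have P: "distinct ?P" and "card (set as) = card (set ?P)"
      using card_length[of ?P] by (metis card_distinct le_antisym, linarith)
    moreover have "set as \<subseteq> set ?P" using Nil by (simp only: set_partials)
    ultimately have "set as = set ?P" by (metis List.finite_set card_subset_eq)
    then have "mset as = mset ?P" using True P by (simp only: set_eq_iff_mset_eq_distinct)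
    from wedge_perm[OF this, of "[]"] obtain c where "wedge as = ext_scale c (wedge ?P)" by auto
    then show ?thesis by (simp add: ext.span_base ext.span_scale)
  qed (simp add: wedge_not_distinct ext.span_zero)
next
  case (Cons D bs)
  then have "D \<in> der.span (range partial)" by simp
  then show ?case
  proof (induction rule: der.span_induct_alt)
    case base
    show ?case by (simp add: ext.span_zero)
  next
    case (step c E F)
    have "wedge (as @ E # bs) \<in> ext.span {wedge partials}"
      using Cons.IH[of "as @ [E]"] Cons.prems step(1) by simp
    then show ?case using step(2)
      by (simp only: wedge_add wedge_scale ext.span_add ext.span_scale)
  qed
qed

section \<open>The grading and the lowest component of the exterior power\<close>

lemma der_homog_empty:
  assumes "e < -1" "D \<in> der_homog e"
  shows "D = (0 :: ('n::finite, 'k::field_prime_char) der)"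
proof -
  have "{der_mult (\<Prod>i\<in>UNIV. xvar i ^ a i) (partial j) | a j.
        (\<forall>i. a i \<le> CHAR('k) - 1) \<and> int (\<Sum>i\<in>UNIV. a i) - 1 = e} = ({} :: ('n, 'k) der set)"
    using assms(1) by (auto simp del: of_nat_sum)
  then show ?thesis using assms(2) unfolding der_homog_def by (metis der.span_empty singletonD)
qed

lemma der_homog_minus_1:
  "der_homog (-1) = (der.span (range partial) :: ('n::finite, 'k::field_prime_char) der set)"
proof -
  have 1: "der_mult 1 D = D" for D :: "('n, 'k) der"
    by (simp add: der_app_inject[symmetric] fun_eq_iff)
  have "{der_mult (\<Prod>i\<in>UNIV. xvar i ^ a i) (partial j) | a j.
        (\<forall>i. a i \<le> CHAR('k) - 1) \<and> int (\<Sum>i\<in>UNIV. a i) - 1 = -1} =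
      (range partial :: ('n, 'k) der set)" (is "?L = _")
  proof
    show "?L \<subseteq> range partial"
    proof clarify
      fix a :: "'n \<Rightarrow> nat" and j
      assume "int (\<Sum>i\<in>UNIV. a i) - 1 = -1"
      then have "\<forall>i. a i = 0" by (simp del: of_nat_sum)
      then show "der_mult (\<Prod>i\<in>UNIV. xvar i ^ a i) (partial j) \<in> (range partial :: ('n, 'k) der set)"
        by (simp add: 1)
    qed
    show "range partial \<subseteq> ?L"
      by (auto intro!: exI[of _ "\<lambda>_. 0"] simp: 1)
  qed
  then show ?thesis unfolding der_homog_def by simp
qed

text \<open>Away from degree -1 each spanning monomial contains some variable with positive
  exponent, which kills the constant term.\<close>

lemma const_term_der_homog:
  fixes D :: "('n::finite, 'k::field_prime_char) der"
  assumes "D \<in> der_homog e" "e \<noteq> -1"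
  shows "const_term (der_app D (xvar i)) = 0"
  using assms(1) unfolding der_homog_def
proof (induction rule: der.span_induct_alt)
  case (step c E F)
  from step(1) obtain a j where E: "E = der_mult (\<Prod>i\<in>UNIV. xvar i ^ a i) (partial j)"
    and a: "int (\<Sum>i\<in>UNIV. a i) - 1 = e" by blast
  have "(\<Sum>i\<in>UNIV. a i) \<noteq> 0" using a assms(2) by (auto simp del: sum_eq_0_iff of_nat_sum)
  then obtain l where "a l \<noteq> 0" by auto
  then have "(\<Prod>i\<in>UNIV. const_term (xvar i :: ('n, 'k) trunc) ^ a i) = 0"
    by (auto intro!: prod_zero)
  then have "const_term (der_app E (xvar i)) = 0"
    by (simp add: E const_term_mult const_term_prod const_term_power)
  then show ?case using step(2) by (simp add: der_app_plus const_term_add const_term_scale)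
qed simp

lemma wedge_coeff_wedge_homog:
  assumes "w \<in> wedge_homog d" "d \<noteq> - int CARD('n)"
  shows "wedge_coeff (w :: ('n::{finite,linorder}, 'k::field_prime_char) ext) = 0"
  using assms(1) unfolding wedge_homog_def
proof (induction rule: ext.span_induct_alt)
  case (step c x y)
  from step(1) obtain ds e where x: "x = wedge ds" and len: "length ds = CARD('n)"
    and e: "\<forall>i<CARD('n). ds ! i \<in> der_homog (e i)" "(\<Sum>i<CARD('n). e i) = d" by blast
  \<comment> \<open>Degrees that are all -1 would sum to -n. The exceptional factor contributes a
    zero row to the determinant.\<close>
  have "\<exists>i<CARD('n). e i \<noteq> -1"
  proof (rule ccontr)
    assume "\<not> ?thesis"
    then have "(\<Sum>i<CARD('n). e i) = (\<Sum>i<CARD('n). -1)" by (intro sum.cong) auto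
    then show False using e(2) assms(2) by simp
  qed
  then obtain i where i: "i < CARD('n)" "e i \<noteq> -1" by blast
  have D: "const_term (der_app (ds ! i) (xvar s)) = 0" for s
    using const_term_der_homog[of "ds ! i" "e i" s] e(1) i by auto
  have "ds = take i ds @ ds ! i # drop (Suc i) ds"
    using i len by (simp add: id_take_nth_drop)
  then have "wedge_det ds = 0 * wedge_det ds + 0 * wedge_det ds"
    using wedge_det_linear[of "ds ! i" 0 "ds ! i" 0 "ds ! i" "take i ds" "drop (Suc i) ds"] D by simp
  then show ?case using step(2) x by (simp add: wedge_coeff_add wedge_coeff_scale wedge_coeff_wedge)
qed simp

text \<open>The degrees \<open>e i\<close> are arbitrary integers. One below -1 makes its factor,
  and hence the wedge, zero; otherwise all are at least -1 and the sum -n forces equality.\<close>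

lemma wedge_homog_bottom:
  "wedge_homog (- int CARD('n)) \<subseteq>
     (ext.span {wedge partials} :: ('n::{finite,linorder}, 'k::field_prime_char) ext set)"
  unfolding wedge_homog_def
proof (rule ext.span_minimal[OF _ ext.subspace_span], clarify)
  fix ds :: "('n, 'k) der list" and e
  assume len: "length ds = CARD('n)" and e: "\<forall>i<CARD('n). ds ! i \<in> der_homog (e i)"
    "(\<Sum>i<CARD('n). e i) = - int CARD('n)"
  show "wedge ds \<in> ext.span {wedge partials}"
  proof (cases "\<exists>i<CARD('n). e i < -1")
    case True
    then obtain i where i: "i < CARD('n)" "e i < -1" by blast
    then have "ds ! i = 0" using der_homog_empty e(1) by blast
    then have "ds = take i ds @ 0 # drop (Suc i) ds"
      using i len by (metis id_take_nth_drop)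
    then have "wedge ds = 0" by (metis wedge_zero)
    then show ?thesis by (simp add: ext.span_zero)
  next
    case False
    have "(\<Sum>i<CARD('n). e i + 1) = 0" using e(2) by (simp add: sum.distrib)
    then have "\<forall>i<CARD('n). e i = -1"
      using False by (subst (asm) sum_nonneg_eq_0_iff) (fastforce simp: eq_neg_iff_add_eq_0 not_less)+
    then have "set ds \<subseteq> der.span (range partial)"
      using e(1) len by (auto simp: in_set_conv_nth der_homog_minus_1)
    then show ?thesis using wedge_partials_span[of "[]" ds] len by simp
  qed
qed

lemma wedge_coeff_partials:
  "wedge_coeff (wedge partials :: ('n::{finite,linorder}, 'k::field_prime_char) ext) = 1"
proof -
  have "mat CARD('n) CARD('n) (\<lambda>(r, s). const_term (der_app
      ((partials :: ('n, 'k) der list) ! r) (xvar (idx s)))) = 1\<^sub>m CARD('n)"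
    by (rule eq_matI) auto
  then show ?thesis by (simp add: wedge_coeff_wedge wedge_det_def)
qed

abbreviation higher_wedges :: "('n::finite, 'k::field_prime_char) ext set" where
  "higher_wedges \<equiv> ext.span (\<Union>d'\<in>-{- int CARD('n)}. wedge_homog d')"

lemma wedge_coeff_higher:
  assumes "v \<in> (higher_wedges :: ('n::{finite,linorder}, 'k::field_prime_char) ext set)"
  shows "wedge_coeff v = 0"
  using assms
  by (induction rule: ext.span_induct_alt)
    (auto simp: wedge_coeff_add wedge_coeff_scale wedge_coeff_wedge_homog)

text \<open>Once some decomposition is known, \<open>wedge_coeff\<close> determines its lowest part:
  that part is a multiple of \<open>wedge partials\<close>, where the functional is 1, and the rest
  is killed.\<close>

lemma wedge_component_bottom:
  fixes w :: "('n::{finite,linorder}, 'k::field_prime_char) ext"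
  assumes "u \<in> wedge_homog (- int CARD('n))" "v \<in> higher_wedges" "w = u + v"
  shows "wedge_component (- int CARD('n)) w = ext_scale (wedge_coeff w) (wedge partials)"
proof -
  have *: "u = ext_scale (wedge_coeff w) (wedge partials)"
    if "u \<in> wedge_homog (- int CARD('n))" "v \<in> higher_wedges" "w = u + v" for u v
  proof -
    from that(1) obtain c where "u = ext_scale c (wedge partials)"
      using wedge_homog_bottom[where ?'n = 'n and ?'k = 'k] by (auto simp: ext.span_singleton)
    then show ?thesis
      using that by (simp add: wedge_coeff_add wedge_coeff_scale wedge_coeff_higher wedge_coeff_partials)
  qed
  show ?thesis
    unfolding wedge_component_def
  proof (rule the_equality)
    show "ext_scale (wedge_coeff w) (wedge (partials :: ('n, 'k) der list)) \<in> wedge_homog (- int CARD('n)) \<and>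
        (\<exists>v\<in>higher_wedges. w = ext_scale (wedge_coeff w) (wedge partials) + v)"
      unfolding *[OF assms, symmetric] using assms by blast
  qed (use * in blast)
qed

text \<open>\<open>es\<close> lists the degrees of the factors already split. Their total exceeds
  the minimum, and since each further factor contributes -1 or 0, the excess survives to the
  end.\<close>

lemma wedge_mixed_higher:
  fixes as bs :: "('n::{finite,linorder}, 'k::field_prime_char) der list"
  assumes "list_all2 (\<lambda>D e. D \<in> der_homog e) as es" "sum_list es > - int (length as)"
    "\<forall>D\<in>set bs. \<exists>A\<in>der_homog (-1). \<exists>B\<in>der_homog 0. D = A + B"
    "length as + length bs = CARD('n)"
  shows "wedge (as @ bs) \<in> higher_wedges"
  using assms
proof (induction bs arbitrary: as es)
  case Nil
  then have len: "length es = CARD('n)" "length as = CARD('n)"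
    by (auto dest: list_all2_lengthD)
  then have "(\<Sum>i<CARD('n). es ! i) = sum_list es"
    by (simp add: sum_list_sum_nth atLeast0LessThan)
  then have "wedge as \<in> wedge_homog (sum_list es)"
    using Nil(1) len unfolding wedge_homog_def
    by (intro ext.span_base CollectI exI[of _ as] conjI refl exI[of _ "\<lambda>i. es ! i"])
      (auto simp: list_all2_conv_all_nth)
  moreover have "sum_list es \<noteq> - int CARD('n)" using Nil len by simp
  ultimately show ?case by (auto intro!: ext.span_base)
next
  case (Cons D bs)
  then obtain A B where D: "D = A + B" "A \<in> der_homog (-1)" "B \<in> der_homog 0" by auto
  have "wedge ((as @ [A]) @ bs) \<in> higher_wedges"
    using Cons.prems D by (intro Cons.IH[of _ "es @ [-1]"] list_all2_appendI) auto
  moreover have "wedge ((as @ [B]) @ bs) \<in> higher_wedges"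
    using Cons.prems D by (intro Cons.IH[of _ "es @ [0]"] list_all2_appendI) auto
  ultimately show ?case by (simp add: D(1) wedge_add ext.span_add)
qed

text \<open>Expand factor by factor. The term with only degree -1 parts is the lowest component;
  every other term has a first factor \<open>B\<close> of degree 0 and is absorbed by
  \<open>wedge_mixed_higher\<close>.\<close>

lemma wedge_split:
  fixes as bs :: "('n::{finite,linorder}, 'k::field_prime_char) der list"
  assumes "set as \<subseteq> der_homog (-1)"
    "\<forall>D\<in>set bs. \<exists>A\<in>der_homog (-1). \<exists>B\<in>der_homog 0. D = A + B"
    "length as + length bs = CARD('n)"
  shows "\<exists>u\<in>wedge_homog (- int CARD('n)). \<exists>v\<in>higher_wedges. wedge (as @ bs) = u + v"
  using assms
proof (induction bs arbitrary: as)
  case Nil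
  have "wedge as \<in> wedge_homog (- int CARD('n))"
    using Nil unfolding wedge_homog_def
    by (intro ext.span_base CollectI exI[of _ as] conjI refl exI[of _ "\<lambda>i. -1"]) auto
  moreover have "wedge (as @ []) = wedge as + 0" by simp
  ultimately show ?case using ext.span_zero by blast
next
  case (Cons D bs)
  then obtain A B where D: "D = A + B" "A \<in> der_homog (-1)" "B \<in> der_homog 0" by auto
  obtain u v where uv: "u \<in> wedge_homog (- int CARD('n))" "v \<in> higher_wedges"
    "wedge ((as @ [A]) @ bs) = u + v"
    using Cons.IH[of "as @ [A]"] Cons.prems D by auto
  \<comment> \<open>Degree -1 for the factors already chosen and 0 for \<open>B\<close>: an excess
    of 1 over the minimum.\<close>
  let ?es = "replicate (length as) (-1) @ [0 :: int]"
  have "list_all2 (\<lambda>D e. D \<in> der_homog e) (as @ [B]) ?es"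
    using Cons.prems(1) D(3)
    by (intro list_all2_appendI) (auto simp: list_all2_conv_all_nth)
  then have "wedge ((as @ [B]) @ bs) \<in> higher_wedges"
    using Cons.prems by (intro wedge_mixed_higher[where es = ?es]) (auto simp: sum_list_replicate)
  then have "v + wedge ((as @ [B]) @ bs) \<in> higher_wedges" using uv(2) by (rule ext.span_add[rotated])
  moreover have "wedge (as @ D # bs) = u + (v + wedge ((as @ [B]) @ bs))"
    using uv(3) by (simp add: D(1) wedge_add add.assoc)
  ultimately show ?case using uv(1) by blast
qed


subsection \<open>The functions \<open>Delta\<close> on the torus\<close>

lemma tor_split: "\<exists>A\<in>der_homog (-1). \<exists>B\<in>der_homog 0.
    (tor \<xi> :: ('n::finite, 'k::field_prime_char) der) = A + B"
proof (intro bexI)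
  let ?A = "\<Sum>i\<in>UNIV. der_scale (\<xi> i) (partial i) :: ('n, 'k) der"
  let ?B = "\<Sum>i\<in>UNIV. der_scale (\<xi> i) (der_mult (xvar i) (partial i)) :: ('n, 'k) der"
  have "der_mult (1 + g) D = D + der_mult g D" for g and D :: "('n, 'k) der"
    by (simp add: der_app_inject[symmetric] fun_eq_iff der_app_plus distrib_right)
  then show "tor \<xi> = ?A + ?B"
    by (simp add: tor_def der.scale_right_distrib sum.distrib)
  show "?A \<in> der_homog (-1)"
    unfolding der_homog_minus_1 by (intro der.span_sum der.span_scale der.span_base) simp
  have "der_mult (xvar i) (partial i) \<in> (der_homog 0 :: ('n, 'k) der set)" for i
  proof -
    let ?a = "\<lambda>j. if j = i then 1 else 0 :: nat"
    have "(\<Prod>j\<in>UNIV. xvar j ^ ?a j :: ('n, 'k) trunc) = (\<Prod>j\<in>{i}. xvar j)"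
      by (rule prod.mono_neutral_cong_right) auto
    \<comment> \<open>The exponent 1 must be admissible, that is, at most p - 1.\<close>
    moreover have "CHAR('k) \<ge> 2" using prime_ge_2_nat[OF prime_CHAR_field] .
    ultimately show ?thesis
      unfolding der_homog_def
      by (intro der.span_base CollectI exI[of _ ?a] exI[of _ i]) auto
  qed
  then show "?B \<in> der_homog 0"
    unfolding der_homog_def by (intro der.span_sum der.span_scale) blast
qed

text \<open>Lists count from 0 and the replaced factor from 1, whence \<open>k + 1 = i\<close>. This
  never holds for \<open>i = 0\<close>, so one formula also covers the unmodified list.\<close>

lemma delta_list_tor:
  assumes "i \<le> CARD('n)"
  shows "delta_list i (tor \<xi> :: ('n::finite, 'k::field_prime_char) der) =
    map (\<lambda>k. tor (\<lambda>j. \<xi> j ^ (CHAR('k) ^ (if k + 1 = i then CARD('n) else k)))) [0..<CARD('n)]"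
  using assms
  by (intro nth_equalityI)
    (auto simp: delta_list_def power_list_def der_power_tor nth_list_update)

lemma const_term_tor_xvar: "const_term (der_app (tor \<xi>) (xvar i)) = \<xi> i"
proof -
  have "der_app (tor \<xi>) (xvar i) = der_app (tor \<xi>) (1 + xvar i)"
    using der_app_const[of "tor \<xi>" 1] by (simp add: der_app_add trunc_const_1)
  then show ?thesis
    by (simp add: tor_one_plus_xvar const_term_scale const_term_add)
qed

lemma Delta_tor:
  fixes \<xi> :: "'n::{finite,linorder} \<Rightarrow> 'k::field_prime_char"
  assumes i: "i \<le> CARD('n)"
  shows "Delta i (tor \<xi>) = det (mat CARD('n) CARD('n)
    (\<lambda>(k, j). \<xi> (idx j) ^ (CHAR('k) ^ (if k + 1 = i then CARD('n) else k))))"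
proof -
  let ?ds = "delta_list i (tor \<xi>)"
  have len: "length ?ds = CARD('n)" by (simp add: delta_list_tor[OF i])
  have "\<forall>D\<in>set ?ds. \<exists>A\<in>der_homog (-1). \<exists>B\<in>der_homog 0. D = A + B"
    unfolding delta_list_tor[OF i] using tor_split by auto
  from wedge_split[of "[]", OF _ this] len obtain u v where
    "u \<in> wedge_homog (- int CARD('n))" "v \<in> higher_wedges" "wedge ?ds = u + v" by auto
  from wedge_component_bottom[OF this] have comp: "wedge_component (- int CARD('n)) (wedge ?ds) =
      ext_scale (wedge_det ?ds) (wedge partials)"
    by (simp only: wedge_coeff_wedge)
  have "Delta i (tor \<xi>) = wedge_det ?ds"
    unfolding Delta_def comp
  proof (rule the_equality)
    fix c
    assume "ext_scale (wedge_det ?ds) (wedge partials) = ext_scale c (wedge (partials :: ('n, 'k) der list))"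
    from arg_cong[OF this, of wedge_coeff] show "c = wedge_det ?ds"
      by (simp add: wedge_coeff_scale wedge_coeff_partials)
  qed simp
  also have "\<dots> = det (mat CARD('n) CARD('n)
      (\<lambda>(k, j). \<xi> (idx j) ^ (CHAR('k) ^ (if k + 1 = i then CARD('n) else k))))"
    unfolding wedge_det_def using len
    by (simp, intro arg_cong[of _ _ det] cong_mat)
      (auto simp: delta_list_tor[OF i] const_term_tor_xvar)
  finally show ?thesis .
qed


subsection \<open>Dickson's polynomial\<close>

text \<open>For \<open>C \<noteq> 0\<close> both sides are monic of degree p and vanish at the p
  distinct multiples of \<open>C\<close>, so they agree. For \<open>C = 0\<close> these points
  coincide, and both sides reduce to the p-th power of the variable.\<close>

lemma prod_linear_prime_field:
  fixes C :: "'k::field_prime_char"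
  shows "(\<Prod>y<CHAR('k). [:- (of_nat y * C), 1:]) =
    Polynomial.monom 1 CHAR('k) - Polynomial.monom (C ^ (CHAR('k) - 1)) 1"
proof (cases "C = 0")
  case True
  have "CHAR('k) - 1 > 0" using prime_gt_1_nat[OF prime_CHAR_field[where ?'k = 'k]] by simp
  moreover have "[:0, 1 :: 'k:] = Polynomial.monom 1 1" by (simp add: monom_altdef)
  ultimately show ?thesis using True by (simp add: monom_power zero_power)
next
  case False
  let ?p = "CHAR('k)" and ?L = "\<Prod>y<CHAR('k). [:- (of_nat y * C), 1:]"
    and ?R = "Polynomial.monom 1 CHAR('k) - Polynomial.monom (C ^ (CHAR('k) - 1)) 1"
  let ?A = "(\<lambda>y. of_nat y * C) ` {..<?p}"
  have p: "?p > 1" using prime_gt_1_nat[OF prime_CHAR_field[where ?'k = 'k]] by simp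
  have deg: "Polynomial.degree ?L = ?p"
    by (subst degree_prod_eq_sum_degree) auto
  have "inj_on (\<lambda>y. of_nat y * C) {..<?p}"
    using False of_nat_inj_less_CHAR[where ?'k = 'k] by (auto simp: inj_on_def)
  then have card: "card ?A = ?p" by (simp add: card_image)
  show ?thesis
  proof (rule poly_eqI_degree_lead_coeff[of _ ?p _ ?A])
    have "Polynomial.lead_coeff ?L = 1" by (simp add: lead_coeff_prod)
    then show "poly.coeff ?L ?p = poly.coeff ?R ?p" using deg p by simp
    show "Polynomial.degree ?R \<le> ?p"
      using p by (intro degree_diff_le order.trans[OF degree_monom_le]) auto
    fix z assume "z \<in> ?A"
    then obtain y where y: "y < ?p" "z = of_nat y * C" by blast
    have "poly ?R z = (of_nat y * C) ^ ?p - C ^ (?p - 1) * (of_nat y * C)"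
      by (simp add: poly_monom y(2))
    also have "(of_nat y * C) ^ ?p = of_nat y * C ^ ?p"
      using power_CHAR_of_nat[where ?'k = 'k, of y 1] by (simp add: power_mult_distrib)
    also have "C ^ ?p = C ^ (?p - 1) * C"
      by (rule power_minus_mult[symmetric]) simp
    finally have "poly ?R z = 0" by (simp add: mult_ac)
    moreover have "poly ?L z = 0" using y by (auto simp: poly_prod)
    ultimately show "poly ?L z = poly ?R z" by simp
  qed (use deg card in auto)
qed

text \<open>A combination of p-power monomials is additive: P(t - d) = P(t) - P(d). Frobenius in the
  polynomial ring is applied to t = (t - d) + d.\<close>

lemma pcompose_CHAR_poly:
  fixes c :: "nat \<Rightarrow> 'k::field_prime_char" and m :: nat
  shows "pcompose (\<Sum>k\<le>m. Polynomial.monom (c k) (CHAR('k) ^ k)) [:- d, 1:] =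
    (\<Sum>k\<le>m. Polynomial.monom (c k) (CHAR('k) ^ k)) -
    [:poly (\<Sum>k\<le>m. Polynomial.monom (c k) (CHAR('k) ^ k)) d:]"
proof -
  have power: "pcompose (q ^ j) r = pcompose q r ^ j" for q r :: "'k poly" and j
    by (induction j) (simp_all add: pcompose_mult pcompose_1)
  have "pcompose (Polynomial.monom b (CHAR('k) ^ k)) [:- d, 1:] =
      Polynomial.monom b (CHAR('k) ^ k) - [:b * d ^ (CHAR('k) ^ k):]" for b and k :: nat
  proof -
    have "prime CHAR('k poly)" by (simp add: prime_CHAR_field)
    from freshmans_dream'[OF this refl, where n = k and x = "[:- d, 1:]" and y = "[:d:]"]
    have "[:0, 1:] ^ (CHAR('k) ^ k) = [:- d, 1:] ^ (CHAR('k) ^ k) + [:d:] ^ (CHAR('k) ^ k)"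
      by simp
    then have "[:- d, 1:] ^ (CHAR('k) ^ k) = [:0, 1:] ^ (CHAR('k) ^ k) - [:d ^ (CHAR('k) ^ k):]"
      by (simp add: poly_const_pow algebra_simps)
    then show ?thesis
      by (simp add: monom_altdef pcompose_smult power pcompose_pCons smult_diff_right)
  qed
  moreover have "(\<Sum>k\<in>K. [:f k:]) = [:\<Sum>k\<in>K. f k:]" for K :: "nat set" and f :: "nat \<Rightarrow> 'k"
    by (induction K rule: infinite_finite_induct) simp_all
  ultimately show ?thesis
    by (simp add: pcompose_sum poly_sum poly_monom sum_subtractf)
qed

text \<open>If P belongs to \<open>A\<close>, the product for \<open>insert x A\<close> runs over
  the translates P(t - y \<xi>), where \<xi> is the new coordinate. With C = P(\<xi>), additivity
  makes these P - y C, and their product is P^p - C^(p-1) P, again a combination of p-power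
  monomials.\<close>

lemma prod_linear_prime_field_lincombs:
  fixes \<xi> :: "'i \<Rightarrow> 'k::field_prime_char"
  assumes "finite A"
  shows "\<exists>c. c (card A) = 1 \<and>
    (\<Prod>a\<in>A \<rightarrow>\<^sub>E {..<CHAR('k)}. [:- (\<Sum>i\<in>A. of_nat (a i) * \<xi> i), 1:]) =
    (\<Sum>k\<le>card A. Polynomial.monom (c k) (CHAR('k) ^ k))"
  using assms
proof (induction A rule: finite_induct)
  case empty
  show ?case by (intro exI[of _ "\<lambda>_. 1"]) (simp add: monom_altdef)
next
  case (insert x A)
  let ?p = "CHAR('k)" and ?m = "card A"
  let ?F = "\<lambda>A. \<Prod>a\<in>A \<rightarrow>\<^sub>E {..<?p}. [:- (\<Sum>i\<in>A. of_nat (a i) * \<xi> i), 1:]"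
  obtain c where c: "c ?m = 1" "?F A = (\<Sum>k\<le>?m. Polynomial.monom (c k) (?p ^ k))"
    using insert.IH by blast
  define P where "P = (\<Sum>k\<le>?m. Polynomial.monom (c k) (?p ^ k))"
  define C where "C = poly P (\<xi> x)"
  have p: "?p > 1" using prime_gt_1_nat[OF prime_CHAR_field[where ?'k = 'k]] by simp
  have lin: "(\<Sum>i\<in>insert x A. of_nat ((g(x := y)) i) * \<xi> i) =
      of_nat y * \<xi> x + (\<Sum>i\<in>A. of_nat (g i) * \<xi> i)" for g y
    using insert.hyps by (auto intro!: sum.cong)
  \<comment> \<open>A function on \<open>insert x A\<close> is a pair: its value \<open>y\<close> at
    \<open>x\<close> and its restriction \<open>g\<close> to \<open>A\<close>.\<close>
  have inj: "inj_on (\<lambda>(y, g). g(x := y)) ({..<?p} \<times> (A \<rightarrow>\<^sub>E {..<?p}))"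
    using inj_combinator[OF insert.hyps(2), of "\<lambda>_. {..<?p}"] by simp
  have "?F (insert x A) = (\<Prod>(y, g)\<in>{..<?p} \<times> (A \<rightarrow>\<^sub>E {..<?p}).
      [:- (of_nat y * \<xi> x + (\<Sum>i\<in>A. of_nat (g i) * \<xi> i)), 1:])"
    unfolding PiE_insert_eq prod.reindex[OF inj]
    by (rule prod.cong) (simp_all only: o_def case_prod_unfold lin)
  also have "\<dots> = (\<Prod>y<?p. \<Prod>g\<in>A \<rightarrow>\<^sub>E {..<?p}.
      pcompose [:- (\<Sum>i\<in>A. of_nat (g i) * \<xi> i), 1:] [:- (of_nat y * \<xi> x), 1:])"
    by (simp add: prod.cartesian_product pcompose_pCons add.commute)
  also have "\<dots> = (\<Prod>y<?p. pcompose P [:- (of_nat y * \<xi> x), 1:])"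
    by (simp only: flip: pcompose_prod) (simp only: c(2) P_def)
  also have "\<dots> = (\<Prod>y<?p. P - [:of_nat y * C:])"
  proof -
    \<comment> \<open>P is linear over the prime field, because its elements are fixed by
      Frobenius.\<close>
    have "poly P (of_nat y * \<xi> x) = of_nat y * C" for y
      by (simp add: P_def C_def poly_sum poly_monom power_mult_distrib power_CHAR_of_nat
          sum_distrib_left mult_ac)
    then show ?thesis unfolding P_def pcompose_CHAR_poly by (simp flip: P_def)
  qed
  \<comment> \<open>Substituting P for the variable brings the product into the form of
    \<open>prod_linear_prime_field\<close>.\<close>
  also have "\<dots> = pcompose (\<Prod>y<?p. [:- (of_nat y * C), 1:]) P"
  proof -
    have shift: "pcompose [:- z, 1:] P = P - [:z:]" for z
      using diff_conv_add_uminus[of P "[:z:]"] by (simp add: pcompose_pCons add.commute)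
    show ?thesis by (simp only: pcompose_prod shift)
  qed
  also have "\<dots> = P ^ ?p - Polynomial.smult (C ^ (?p - 1)) P"
  proof -
    have "pcompose (q ^ j) P = pcompose q P ^ j" for q :: "'k poly" and j
      by (induction j) (simp_all add: pcompose_mult pcompose_1)
    then show ?thesis
      by (simp add: prod_linear_prime_field pcompose_diff monom_altdef pcompose_smult pcompose_pCons)
  qed
  also have "P ^ ?p = (\<Sum>k\<le>?m. Polynomial.monom (c k ^ ?p) (?p ^ Suc k))"
  proof -
    have "prime CHAR('k poly)" by (simp add: prime_CHAR_field)
    from freshmans_dream_sum[OF this refl, of "\<lambda>k. Polynomial.monom (c k) (?p ^ k)" "{..?m}"]
    show ?thesis
      by (simp add: P_def Polynomial.monom_power mult.commute)
  qed
  \<comment> \<open>The p-th power shifts coefficients up by one index, while the subtracted term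
    stays within \<open>k \<le> ?m\<close>. The top coefficient is therefore
    \<open>c ?m ^ ?p = 1\<close>.\<close>
  also have "\<dots> - Polynomial.smult (C ^ (?p - 1)) P =
      (\<Sum>k\<le>Suc ?m. Polynomial.monom ((if k = 0 then 0 else c (k - 1) ^ ?p) -
        (if k \<le> ?m then C ^ (?p - 1) * c k else 0)) (?p ^ k))"
  proof -
    have "(\<Sum>k\<le>Suc ?m. Polynomial.monom (if k = 0 then 0 else c (k - 1) ^ ?p) (?p ^ k)) =
        (\<Sum>k\<le>?m. Polynomial.monom (c k ^ ?p) (?p ^ Suc k))"
      by (subst sum.atMost_Suc_shift) simp
    moreover have "(\<Sum>k\<le>Suc ?m. Polynomial.monom (if k \<le> ?m then C ^ (?p - 1) * c k else 0) (?p ^ k)) =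
        Polynomial.smult (C ^ (?p - 1)) P"
      by (simp add: P_def smult_sum2 smult_monom)
    ultimately show ?thesis
      by (simp only: flip: diff_monom) (simp only: sum_subtractf)
  qed
  finally show ?case
    using c(1) insert.hyps by (intro exI[of _ "\<lambda>k. (if k = 0 then 0 else c (k - 1) ^ ?p) -
        (if k \<le> ?m then C ^ (?p - 1) * c k else 0)"]) simp
qed

lemma box_PiE: "box p = (UNIV \<rightarrow>\<^sub>E {..<p})"
  by (auto simp: box_def PiE_UNIV_domain)

lemma power_CHAR_dim:
  fixes \<xi> :: "'n::{finite,linorder} \<Rightarrow> 'k::field_prime_char"
  shows "\<xi> i ^ (CHAR('k) ^ CARD('n)) = (\<Sum>k<CARD('n). - psi k (tor \<xi>) * \<xi> i ^ (CHAR('k) ^ k))"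
proof -
  let ?p = "CHAR('k)" and ?n = "CARD('n)"
  have p: "?p > 1" using prime_gt_1_nat[OF prime_CHAR_field[where ?'k = 'k]] by simp
  let ?F = "\<Prod>a\<in>box ?p. [:- (\<Sum>i\<in>UNIV. of_nat (a i) * \<xi> i), 1:]"
  obtain c where c: "c ?n = 1" "?F = (\<Sum>k\<le>?n. Polynomial.monom (c k) (?p ^ k))"
    using prod_linear_prime_field_lincombs[of "UNIV :: 'n set" \<xi>] unfolding box_PiE by auto
  have psi: "psi l (tor \<xi>) = c l" if "l < ?n" for l
  proof -
    \<comment> \<open>As p > 1, different \<open>k\<close> give different exponents, so coefficients
      can be read off term by term.\<close>
    have "psi l (tor \<xi>) = (\<Sum>k\<le>?n. if l = k then c k else 0)"
      unfolding psi_def trunc_char_poly_tor c(2) coeff_sum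
      using p by (intro sum.cong) auto
    then show ?thesis using that by simp
  qed
  \<comment> \<open>The unit exponent vector has eigenvalue \<open>\<xi> i\<close>, which is
    therefore a root of the characteristic polynomial.\<close>
  let ?e = "\<lambda>j. if j = i then 1 else 0 :: nat"
  have "(\<Sum>j\<in>UNIV. of_nat (?e j) * \<xi> j) = (\<Sum>j\<in>{i}. \<xi> j)"
    by (rule sum.mono_neutral_cong_right) auto
  then have "poly [:- (\<Sum>j\<in>UNIV. of_nat (?e j) * \<xi> j), 1:] (\<xi> i) = 0" by simp
  moreover have "?e \<in> box ?p" using p by (simp add: box_def)
  ultimately have "poly ?F (\<xi> i) = 0"
    unfolding poly_prod by (intro prod_zero finite_box bexI[of _ ?e])
  then have "(\<Sum>k<?n. c k * \<xi> i ^ (?p ^ k)) + \<xi> i ^ (?p ^ ?n) = 0"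
    unfolding c(2) by (simp add: poly_sum poly_monom c(1) flip: lessThan_Suc_atMost)
  then have "\<xi> i ^ (?p ^ ?n) = - (\<Sum>k<?n. c k * \<xi> i ^ (?p ^ k))"
    by (simp add: eq_neg_iff_add_eq_0 add.commute)
  then show ?thesis by (simp add: psi sum_negf)
qed

text \<open>Cramer's rule in row form. Expanding along row \<open>r\<close>, the other rows of
  \<open>Y\<close> meet alien cofactors and contribute 0, by \<open>Y * adj_mat Y = det Y\<close>
  times the identity.\<close>

lemma det_replace_row:
  fixes X Y :: "'k::comm_ring_1 mat"
  assumes X: "X \<in> carrier_mat n n" and Y: "Y \<in> carrier_mat n n" and r: "r < n"
    and off: "\<And>i j. i < n \<Longrightarrow> j < n \<Longrightarrow> i \<noteq> r \<Longrightarrow> X $$ (i, j) = Y $$ (i, j)"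
    and row: "\<And>j. j < n \<Longrightarrow> X $$ (r, j) = (\<Sum>k<n. b k * Y $$ (k, j))"
  shows "det X = b r * det Y"
proof -
  have "mat_delete X r j = mat_delete Y r j" for j
    using X Y off by (auto simp: mat_delete_def intro!: eq_matI)
  then have cof: "cofactor X r j = cofactor Y r j" for j
    by (simp add: cofactor_def)
  have adj: "(\<Sum>j<n. Y $$ (k, j) * cofactor Y r j) = (if k = r then det Y else 0)" if "k < n" for k
  proof -
    have "(Y * adj_mat Y) $$ (k, r) = (\<Sum>j<n. Y $$ (k, j) * cofactor Y r j)"
      using that r Y by (simp add: adj_mat_def scalar_prod_def atLeast0LessThan)
    then show ?thesis using adj_mat(2)[OF Y] that r by auto
  qed
  have "det X = (\<Sum>j<n. \<Sum>k<n. b k * (Y $$ (k, j) * cofactor Y r j))"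
    by (simp add: laplace_expansion_row[OF X r] row cof sum_distrib_right mult.assoc)
  also have "\<dots> = (\<Sum>k<n. b k * (\<Sum>j<n. Y $$ (k, j) * cofactor Y r j))"
    by (subst sum.swap) (simp add: sum_distrib_left)
  also have "\<dots> = (\<Sum>k<n. if k = r then b r * det Y else 0)"
    by (rule sum.cong) (auto simp: adj)
  finally show ?thesis using r by simp
qed

text \<open>The Moore determinant for \<open>i = 0\<close>, and the Cramer numerators for larger
  \<open>i\<close>; it is the common form of the values of \<open>Delta\<close> and
  \<open>phi\<close> on the torus.\<close>

definition moore_det :: "nat \<Rightarrow> ('n::{finite,linorder} \<Rightarrow> 'k::field_prime_char) \<Rightarrow> 'k" where
  "moore_det i \<xi> = det (mat CARD('n) CARD('n)
     (\<lambda>(k, j). \<xi> (idx j) ^ (CHAR('k) ^ (if k + 1 = i then CARD('n) else k))))"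

lemma moore_det_psi:
  fixes \<xi> :: "'n::{finite,linorder} \<Rightarrow> 'k::field_prime_char"
  assumes "i \<in> {1..CARD('n)}"
  shows "moore_det i \<xi> = - psi (i - 1) (tor \<xi>) * moore_det 0 \<xi>"
  unfolding moore_det_def using assms
  by (intro det_replace_row[where b = "\<lambda>k. - psi k (tor \<xi>)"])
    (auto simp: power_CHAR_dim[of \<xi>] intro!: sum.cong)


subsection \<open>The torus\<close>

text \<open>The constant term of the value at \<open>xvar i\<close> recovers the coordinate. This
  makes the coordinate vector in \<open>phi\<close> unique.\<close>

lemma tor_eq_iff: "tor \<xi> = tor \<eta> \<longleftrightarrow> \<xi> = \<eta>"
  by (metis const_term_tor_xvar ext)

lemma sum_toral_basis:
  "(\<Sum>j<CARD('n). der_scale (\<xi> (idx j)) (toral_basis j)) =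
     (tor \<xi> :: ('n::{finite,linorder}, 'k::field_prime_char) der)"
  unfolding toral_basis_def tor_def
  by (rule sum_idx[of "\<lambda>i. der_scale (\<xi> i) (der_mult (1 + xvar i) (partial i))"])

lemma toral_elt_tor:
  fixes \<xi> :: "'n::{finite,linorder} \<Rightarrow> 'k::field_prime_char"
  assumes "\<forall>j<CARD('n). v $ j = \<xi> (idx j)"
  shows "toral_elt v = tor \<xi>"
  unfolding toral_elt_def sum_toral_basis[symmetric] using assms by (intro sum.cong) auto

lemma toral_eq_range_tor: "toral = range (tor :: ('n \<Rightarrow> 'k) \<Rightarrow> ('n::{finite,linorder}, 'k::field_prime_char) der)"
proof
  show "range tor \<subseteq> (toral :: ('n, 'k) der set)"
  proof clarify
    fix \<xi> :: "'n \<Rightarrow> 'k"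
    show "tor \<xi> \<in> (toral :: ('n, 'k) der set)"
      unfolding toral_def sum_toral_basis[symmetric]
      by (rule der.span_sum, rule der.span_scale, rule der.span_base) simp
  qed
  have tor_add: "der_scale c (tor \<xi>) + tor \<eta> = (tor (\<lambda>i. c * \<xi> i + \<eta> i) :: ('n, 'k) der)" for c \<xi> \<eta>
    by (simp add: tor_def der.scale_sum_right der.scale_left_distrib sum.distrib)
  show "(toral :: ('n, 'k) der set) \<subseteq> range tor"
  proof
    fix D :: "('n, 'k) der"
    assume "D \<in> toral"
    then show "D \<in> range tor"
      unfolding toral_def
    proof (induction rule: der.span_induct_alt)
      case base
      have "tor (\<lambda>_. 0) = (0 :: ('n, 'k) der)" by (simp add: tor_def)
      then show ?case by (metis rangeI)
    next
      case (step c E F)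
      then obtain \<eta> j where "F = tor \<eta>" "E = toral_basis j" by blast
      moreover have "toral_basis j = (tor (\<lambda>i. if i = idx j then 1 else 0) :: ('n, 'k) der)"
      proof -
        have "tor (\<lambda>i. if i = idx j then 1 else 0) =
            (\<Sum>i\<in>UNIV. if i = idx j then der_mult (1 + xvar i) (partial i) else 0 :: ('n, 'k) der)"
          unfolding tor_def by (rule sum.cong) auto
        then show ?thesis by (simp add: toral_basis_def)
      qed
      ultimately show ?case by (simp add: tor_add)
    qed
  qed
qed

lemma dickson_mat_moore:
  fixes \<xi> :: "'n::{finite,linorder} \<Rightarrow> 'k::field_prime_char"
  assumes "v \<in> carrier_vec CARD('n)" "\<forall>j<CARD('n). v $ j = \<xi> (idx j)"
  shows "det (dickson_mat i v) = moore_det i \<xi>"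
  unfolding dickson_mat_def moore_det_def using assms
  by (intro arg_cong[of _ _ det] eq_matI) auto

lemma vec_tor_cases:
  fixes v :: "'k::field_prime_char vec"
  obtains \<xi> :: "'n::{finite,linorder} \<Rightarrow> 'k" where "\<forall>j<CARD('n). v $ j = \<xi> (idx j)"
  using ex_fun_idx[of "\<lambda>j. v $ j"] by metis

lemma phi_tor:
  fixes \<xi> :: "'n::{finite,linorder} \<Rightarrow> 'k::field_prime_char"
  shows "phi i (tor \<xi>) = moore_det i \<xi>"
proof -
  let ?v = "vec CARD('n) (\<lambda>j. \<xi> (idx j))"
  have "(THE v. v \<in> carrier_vec CARD('n) \<and> tor \<xi> = toral_elt v) = ?v"
  proof (rule the_equality)
    show "?v \<in> carrier_vec CARD('n) \<and> tor \<xi> = toral_elt ?v"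
      by (auto intro!: toral_elt_tor[symmetric])
    fix v assume v: "v \<in> carrier_vec CARD('n) \<and> tor \<xi> = toral_elt v"
    obtain \<eta> :: "'n \<Rightarrow> 'k" where \<eta>: "\<forall>j<CARD('n). v $ j = \<eta> (idx j)" by (rule vec_tor_cases)
    then have "\<xi> = \<eta>" using v by (simp add: toral_elt_tor[OF \<eta>] tor_eq_iff)
    then show "v = ?v" using v \<eta> by (intro eq_vecI) auto
  qed
  then have "phi i (tor \<xi>) = det (dickson_mat i ?v)"
    by (simp add: phi_def toral_eq_range_tor)
  also have "\<dots> = moore_det i \<xi>" by (rule dickson_mat_moore) auto
  finally show ?thesis .
qed

section \<open>Semiinvariance under the general linear group over the prime field\<close>

lemma of_int_power_CHAR:
  assumes "x \<in> range of_int"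
  shows "(x :: 'k::field_prime_char) ^ (CHAR('k) ^ k) = x"
proof -
  from assms obtain z where z: "x = of_int z" by blast
  let ?p = "int CHAR('k)"
  have "?p > 0" by simp
  have "(of_int (?p * (z div ?p) + z mod ?p) :: 'k) = of_int (z mod ?p)"
    by (simp only: of_int_add of_int_mult of_int_of_nat_eq of_nat_CHAR) simp
  then have "x = of_int (int (nat (z mod ?p)))"
    using z \<open>?p > 0\<close> by (simp del: of_int_of_nat_eq)
  then have "x = of_nat (nat (z mod ?p))" by (simp only: of_int_of_nat_eq)
  then show ?thesis by (metis power_CHAR_of_nat)
qed

text \<open>Entries of \<open>g\<close> are fixed by Frobenius, so all rows of the Dickson matrix
  transform alike and the matrix is multiplied on the right by the transpose of
  \<open>g\<close>.\<close>

lemma det_dickson_mat_GL_prime: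
  fixes g :: "'k::field_prime_char mat"
  assumes g: "g \<in> GL_prime n" and v: "v \<in> carrier_vec n"
  shows "det (dickson_mat 0 (g *\<^sub>v v)) = det g * det (dickson_mat 0 v)"
proof -
  have gc: "g \<in> carrier_mat n n" and ge: "elements_mat g \<subseteq> range of_int"
    using g by (auto simp: GL_prime_def)
  have "dickson_mat 0 (g *\<^sub>v v) = dickson_mat 0 v * transpose_mat g"
  proof (rule eq_matI)
    fix k j assume "k < dim_row (dickson_mat 0 v * transpose_mat g)"
      "j < dim_col (dickson_mat 0 v * transpose_mat g)"
    then have kj: "k < n" "j < n" using gc v by (auto simp: dickson_mat_def)
    have gjl: "(g $$ (j, l)) ^ (CHAR('k) ^ k) = g $$ (j, l)" if "l < n" for l
      by (rule of_int_power_CHAR[OF subsetD[OF ge elements_matI[OF gc kj(2) that refl]]])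
    have "(g *\<^sub>v v) $ j = (\<Sum>l<n. g $$ (j, l) * v $ l)"
      using gc v kj by (simp add: scalar_prod_def atLeast0LessThan)
    then have "((g *\<^sub>v v) $ j) ^ (CHAR('k) ^ k) = (\<Sum>l<n. g $$ (j, l) * (v $ l) ^ (CHAR('k) ^ k))"
      by (simp add: freshmans_dream_sum'[OF prime_CHAR_field refl] power_mult_distrib gjl)
    then show "dickson_mat 0 (g *\<^sub>v v) $$ (k, j) = (dickson_mat 0 v * transpose_mat g) $$ (k, j)"
      using gc v kj by (simp add: dickson_mat_def scalar_prod_def atLeast0LessThan mult.commute)
  qed (use gc v in \<open>auto simp: dickson_mat_def\<close>)
  then show ?thesis
    using det_mult[of "dickson_mat 0 v" n "transpose_mat g"] det_transpose[OF gc] gc v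
    by (simp add: dickson_mat_def)
qed


subsection \<open>Polynomial functions on the torus\<close>

text \<open>Over a finite field, 1 plus the product of all t - a is nonconstant without
  roots.\<close>

lemma infinite_alg_closed: "infinite (UNIV :: 'k::alg_closed_field set)"
proof
  assume fin: "finite (UNIV :: 'k set)"
  let ?P = "\<Prod>a\<in>UNIV. [:- a, 1 :: 'k:]"
  have "Polynomial.degree ?P = card (UNIV :: 'k set)"
    by (subst degree_prod_eq_sum_degree) auto
  then have deg: "Polynomial.degree ?P > 0" using fin by (simp add: card_gt_0_iff)
  then have "Polynomial.degree (?P + 1) = Polynomial.degree ?P"
    by (intro degree_add_eq_left) simp
  then obtain x where "poly (?P + 1) x = 0"
    using alg_closed_imp_poly_has_root[of "?P + 1"] deg by auto
  moreover have "poly ?P x = 0" using fin by (auto simp: poly_prod)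
  ultimately show False by simp
qed

lemma mpol_eval_line:
  fixes P :: "('n::finite, 'k::comm_ring_1) mpol"
  shows "\<exists>q. \<forall>s. mpol_eval (\<lambda>i. \<xi> i + s * \<eta> i) P = poly q s"
proof (induction P rule: poly_mapping_induct_single)
  case zero
  show ?case by (intro exI[of _ 0]) (simp add: mpol_eval_0)
next
  case (single m c)
  have "mpol_eval (\<lambda>i. \<xi> i + s * \<eta> i) (Poly_Mapping.single m c) =
      poly ([:c:] * (\<Prod>i\<in>UNIV. [:\<xi> i, \<eta> i:] ^ Poly_Mapping.lookup m i)) s" for s
    by (simp add: mpol_eval_pm_lin poly_prod poly_power)
  then show ?case by blast
next
  case (add P Q)
  then obtain q r where "\<forall>s. mpol_eval (\<lambda>i. \<xi> i + s * \<eta> i) P = poly q s"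
    "\<forall>s. mpol_eval (\<lambda>i. \<xi> i + s * \<eta> i) Q = poly r s" by blast
  then show ?case by (intro exI[of _ "q + r"]) (simp add: mpol_eval_add)
qed

text \<open>Restrict to the line from \<open>\<xi>\<close> at s = 0 to \<open>\<rho>\<close> at s =
  1. There \<open>M\<close> becomes a nonzero univariate polynomial, which cancels because the field
  is infinite; then evaluate at s = 0.\<close>

lemma mpol_eval_cancel:
  fixes M P Q :: "('n::finite, 'k::{idom}) mpol"
  assumes inf: "infinite (UNIV :: 'k set)" and M: "mpol_eval \<rho> M \<noteq> 0"
    and eq: "\<And>\<xi>. mpol_eval \<xi> M * mpol_eval \<xi> P = mpol_eval \<xi> M * mpol_eval \<xi> Q"
  shows "mpol_eval \<xi> P = mpol_eval \<xi> Q"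
proof -
  let ?l = "\<lambda>s i. \<xi> i + s * (\<rho> i - \<xi> i)"
  obtain m q r where mqr: "\<And>s. mpol_eval (?l s) M = poly m s" "\<And>s. mpol_eval (?l s) P = poly q s"
    "\<And>s. mpol_eval (?l s) Q = poly r s"
    using mpol_eval_line[of \<xi> "\<lambda>i. \<rho> i - \<xi> i"] by metis
  have "poly m 1 \<noteq> 0" using mqr(1)[of 1] M by simp
  then have "m \<noteq> 0" by auto
  have "poly (m * (q - r)) s = 0" for s
    using eq[of "?l s"] unfolding mqr by simp
  then have "m * (q - r) = 0" using poly_roots_finite[of "m * (q - r)"] inf by auto
  then have "q = r" using \<open>m \<noteq> 0\<close> by simp
  then show ?thesis using mqr(2)[of 0] mqr(3)[of 0] by simp
qed

lemma moore_det_mpol: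
  "\<exists>M. \<forall>\<xi> :: 'n::{finite,linorder} \<Rightarrow> 'k::field_prime_char. moore_det i \<xi> = mpol_eval \<xi> M"
proof (intro exI allI)
  fix \<xi> :: "'n \<Rightarrow> 'k"
  let ?M = "mat CARD('n) CARD('n)
     (\<lambda>(k, j). Var (idx j) ^ (CHAR('k) ^ (if k + 1 = i then CARD('n) else k))) :: ('n, 'k) mpol mat"
  interpret h: comm_ring_hom "mpol_eval \<xi>" by (rule comm_ring_hom_mpol_eval)
  have "map_mat (mpol_eval \<xi>) ?M = mat CARD('n) CARD('n)
     (\<lambda>(k, j). \<xi> (idx j) ^ (CHAR('k) ^ (if k + 1 = i then CARD('n) else k)))"
    by (rule eq_matI) (auto simp: h.hom_power)
  then show "moore_det i \<xi> = mpol_eval \<xi> (det ?M)"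
    unfolding moore_det_def using h.hom_det[of ?M] by (simp only:)
qed

text \<open>Choose \<theta> with pairwise distinct conjugates \<open>\<theta> ^ (p ^ k)\<close> for
  \<open>k < n\<close>, which avoids finitely many roots, and take the powers of \<theta> as
  coordinates: the matrix becomes Vandermonde in these conjugates.\<close>

lemma moore_det_nonzero:
  "\<exists>\<rho> :: 'n::{finite,linorder} \<Rightarrow> 'k::{alg_closed_field,field_prime_char}. moore_det 0 \<rho> \<noteq> 0"
proof -
  let ?n = "CARD('n)" and ?p = "CHAR('k)"
  have p: "?p > 1" using prime_gt_1_nat[OF prime_CHAR_field[where ?'k = 'k]] by simp
  let ?R = "\<lambda>(k, l). {x. poly (Polynomial.monom 1 (?p ^ k) - Polynomial.monom 1 (?p ^ l)) x = (0 :: 'k)}"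
  let ?I = "{(k, l). k < ?n \<and> l < ?n \<and> k \<noteq> l}"
  have "finite (?R kl)" if "kl \<in> ?I" for kl
  proof -
    obtain k l where kl: "kl = (k, l)" "k \<noteq> l" using \<open>kl \<in> ?I\<close> by auto
    have "Polynomial.monom 1 (?p ^ k) - Polynomial.monom 1 (?p ^ l) \<noteq> (0 :: 'k poly)"
      using kl p by (simp add: monom_eq_iff')
    from poly_roots_finite[OF this] show ?thesis by (simp add: kl)
  qed
  moreover have "finite ?I"
    by (rule finite_subset[of _ "{..<?n} \<times> {..<?n}"]) auto
  ultimately have "finite (\<Union>kl\<in>?I. ?R kl)" by blast
  then obtain \<theta> where "\<theta> \<notin> (\<Union>kl\<in>?I. ?R kl)"
    using ex_new_if_finite[OF infinite_alg_closed] by blast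
  then have \<theta>: "\<theta> ^ (?p ^ k) \<noteq> \<theta> ^ (?p ^ l)" if "k < ?n" "l < ?n" "k \<noteq> l" for k l
    using that by (auto simp: poly_monom)
  obtain \<rho> :: "'n \<Rightarrow> 'k" where \<rho>: "\<forall>j<?n. \<rho> (idx j) = \<theta> ^ j"
    using ex_fun_idx by blast
  let ?A = "mat ?n ?n (\<lambda>(k, j). \<rho> (idx j) ^ (?p ^ k))"
  have "det ?A \<noteq> 0"
  proof
    assume "det ?A = 0"
    then obtain v where v: "v \<in> carrier_vec ?n" "v \<noteq> 0\<^sub>v ?n" "?A *\<^sub>v v = 0\<^sub>v ?n"
      using det_0_iff_vec_prod_zero[of ?A ?n] by auto
    \<comment> \<open>\<open>?A\<close> is a Vandermonde matrix, so \<open>v\<close> holds the coefficients of a polynomial of degree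
      less than \<open>n\<close> with \<open>n\<close> roots\<close>
    define w where "w = (\<Sum>j<?n. Polynomial.monom (v $ j) j)"
    have coeff: "poly.coeff w j = v $ j" if "j < ?n" for j
    proof -
      have "poly.coeff w j = (\<Sum>i<?n. if i = j then v $ j else 0)"
        unfolding w_def coeff_sum by (rule sum.cong) auto
      then show ?thesis using that by simp
    qed
    have "w \<noteq> 0"
    proof
      assume "w = 0"
      then have "v = 0\<^sub>v ?n" using coeff v(1) by (intro eq_vecI) auto
      then show False using v(2) by simp
    qed
    have deg: "Polynomial.degree w < ?n"
    proof -
      have "Polynomial.degree w \<le> ?n - 1"
        unfolding w_def by (rule degree_sum_le) (auto intro: order.trans[OF degree_monom_le])
      moreover have "?n > 0" by simp
      ultimately show ?thesis by linarith
    qed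
    have "poly w (\<theta> ^ (?p ^ k)) = 0" if "k < ?n" for k
    proof -
      have "(?A *\<^sub>v v) $ k = (\<Sum>j<?n. \<rho> (idx j) ^ (?p ^ k) * v $ j)"
        using that v(1) by (simp add: scalar_prod_def atLeast0LessThan)
      also have "\<dots> = poly w (\<theta> ^ (?p ^ k))"
        unfolding w_def poly_sum using \<rho>
        by (intro sum.cong) (auto simp: poly_monom mult.commute simp flip: power_mult)
      finally show ?thesis using that by (simp add: v(3))
    qed
    then have "(\<lambda>k. \<theta> ^ (?p ^ k)) ` {..<?n} \<subseteq> {x. poly w x = 0}" by auto
    then have "card ((\<lambda>k. \<theta> ^ (?p ^ k)) ` {..<?n}) \<le> card {x. poly w x = 0}"
      by (rule card_mono[OF poly_roots_finite[OF \<open>w \<noteq> 0\<close>]])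
    moreover have "inj_on (\<lambda>k. \<theta> ^ (?p ^ k)) {..<?n}"
      using \<theta> by (auto simp: inj_on_def)
    ultimately show False
      using card_poly_roots_bound[OF \<open>w \<noteq> 0\<close>] deg by (simp add: card_image)
  qed
  then show ?thesis unfolding moore_det_def by auto
qed

text \<open>The factored characteristic polynomial makes sense with variables in place of the
  coordinates; its coefficients over the polynomial ring are the required polynomials.\<close>

lemma psi_tor_mpol:
  "\<exists>P. \<forall>\<xi> :: 'n::{finite,linorder} \<Rightarrow> 'k::field_prime_char. psi i (tor \<xi>) = mpol_eval \<xi> P"
proof (intro exI allI)
  fix \<xi> :: "'n \<Rightarrow> 'k"
  let ?F = "\<Prod>a\<in>box CHAR('k). [:- (\<Sum>i\<in>UNIV. of_nat (a i) * Var i), 1:] :: ('n, 'k) mpol poly"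
  interpret h: comm_ring_hom "mpol_eval \<xi>" by (rule comm_ring_hom_mpol_eval)
  interpret hp: map_poly_comm_ring_hom "mpol_eval \<xi>" ..
  have "map_poly (mpol_eval \<xi>) ?F =
      (\<Prod>a\<in>box CHAR('k). [:- (\<Sum>i\<in>UNIV. of_nat (a i) * \<xi> i), 1:])"
    by (simp add: hp.hom_prod h.hom_uminus h.hom_sum h.hom_mult h.hom_of_nat)
  then show "psi i (tor \<xi>) = mpol_eval \<xi> (poly.coeff ?F (CHAR('k) ^ i))"
    unfolding psi_def trunc_char_poly_tor
    using coeff_map_poly[of "mpol_eval \<xi>" ?F "CHAR('k) ^ i"] by (simp only: h.hom_zero)
qed

lemma psi_bar_eq:
  assumes i: "i \<in> {1..CARD('n)}"
  shows "psi_bar (i - 1) =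
    (restrict (psi (i - 1)) toral :: ('n::{finite,linorder}, 'k::{alg_closed_field,field_prime_char}) der \<Rightarrow> 'k)"
  and "(restrict (psi (i - 1)) toral :: ('n, 'k) der \<Rightarrow> 'k) \<in> poly_fun_toral"
  and "(D :: ('n, 'k) der) \<in> toral \<Longrightarrow> phi 0 D * restrict (psi (i - 1)) toral D = - phi i D"
proof -
  let ?f = "restrict (psi (i - 1)) toral :: ('n, 'k) der \<Rightarrow> 'k"
  have phi: "phi 0 D * ?f D = - phi i D" if "D \<in> toral" for D
  proof -
    from that obtain \<xi> where D: "D = tor \<xi>" unfolding toral_eq_range_tor by blast
    show ?thesis using that by (simp add: D phi_tor moore_det_psi[OF i])
  qed
  then show "phi 0 D * ?f D = - phi i D" if "D \<in> toral" using that .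
  obtain P :: "('n, 'k) mpol" where P: "\<forall>\<xi>. psi (i - 1) (tor \<xi>) = mpol_eval \<xi> P"
    using psi_tor_mpol by blast
  show f: "?f \<in> poly_fun_toral"
    unfolding poly_fun_toral_def sum_toral_basis
    using P by (auto simp: toral_eq_range_tor intro!: exI[of _ P])
  have i1: "i - 1 + 1 = i" using i by simp
  show "psi_bar (i - 1) = ?f"
    unfolding psi_bar_def i1
  proof (rule the_equality)
    show "?f \<in> poly_fun_toral \<and> (\<forall>D\<in>toral. phi 0 D * ?f D = - phi i D)"
      using f phi by blast
    fix g :: "('n, 'k) der \<Rightarrow> 'k"
    assume g: "g \<in> poly_fun_toral \<and> (\<forall>D\<in>toral. phi 0 D * g D = - phi i D)"
    then obtain Q :: "('n, 'k) mpol" where Q: "\<forall>\<xi>. g (tor \<xi>) = mpol_eval \<xi> Q"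
      unfolding poly_fun_toral_def sum_toral_basis by blast
    obtain M :: "('n, 'k) mpol" where M: "\<forall>\<xi>. moore_det 0 \<xi> = mpol_eval \<xi> M"
      using moore_det_mpol by blast
    obtain \<rho> :: "'n \<Rightarrow> 'k" where \<rho>: "moore_det 0 \<rho> \<noteq> 0" using moore_det_nonzero by blast
    have tor: "tor \<xi> \<in> toral" for \<xi> :: "'n \<Rightarrow> 'k" by (simp add: toral_eq_range_tor)
    have "g (tor \<xi>) = ?f (tor \<xi>)" for \<xi>
    proof -
      \<comment> \<open>Both candidates solve the equation that defines \<open>psi_bar\<close>; the
        common factor \<open>phi 0\<close> is removed as a polynomial function, so its zeros do no
        harm.\<close>
      have "mpol_eval \<xi> M * mpol_eval \<xi> Q = mpol_eval \<xi> M * mpol_eval \<xi> P" for \<xi>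
      proof -
        have "phi 0 (tor \<xi>) * g (tor \<xi>) = phi 0 (tor \<xi>) * ?f (tor \<xi>)"
          using g phi[OF tor] tor by simp
        then show ?thesis using P Q M tor by (simp add: phi_tor)
      qed
      from mpol_eval_cancel[OF infinite_alg_closed _ this] \<rho> M
      have "mpol_eval \<xi> Q = mpol_eval \<xi> P" by metis
      then show ?thesis using P Q tor by simp
    qed
    then have "g D = ?f D" if "D \<in> toral" for D
      using that unfolding toral_eq_range_tor by blast
    \<comment> \<open>Off the torus both functions take the default value, by
      extensionality.\<close>
    moreover have "g D = undefined" if "D \<notin> toral" for D
      using g that by (auto simp: poly_fun_toral_def extensional_def)
    ultimately show "g = ?f" by (auto simp: restrict_def fun_eq_iff)
  qed
qed

theorem mainTheorem6:
  fixes n p :: nat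
  assumes n: "n = CARD('n::{finite,linorder})"
    and p: "p = CHAR('k::{alg_closed_field,field_prime_char})"
    and "p > 2" and "(p, n) \<noteq> (3, 1)"
  shows "(\<forall>i\<le>n. \<forall>\<xi>\<in>carrier_vec n.
            Delta i (toral_elt \<xi> :: ('n, 'k) der) = det (dickson_mat i \<xi>) \<and>
            det (dickson_mat i \<xi>) = phi i (toral_elt \<xi> :: ('n, 'k) der))
       \<and> restrict (Delta 0) toral = (phi 0 :: ('n, 'k) der \<Rightarrow> 'k)
       \<and> (\<forall>g\<in>GL_prime n. \<forall>\<xi>\<in>carrier_vec n.
            phi 0 (toral_elt (g *\<^sub>v \<xi>) :: ('n, 'k) der) =
            det g * phi 0 (toral_elt \<xi> :: ('n, 'k) der))
       \<and> (\<forall>i\<in>{1..n}.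
            restrict (psi (i - 1)) toral = (psi_bar (i - 1) :: ('n, 'k) der \<Rightarrow> 'k) \<and>
            psi_bar (i - 1) \<in> (poly_fun_toral :: (('n, 'k) der \<Rightarrow> 'k) set) \<and>
            (\<forall>D\<in>(toral :: ('n, 'k) der set). phi 0 D * psi_bar (i - 1) D = - phi i D))"
proof (intro conjI allI impI ballI)
  have phi_det: "det (dickson_mat i v) = phi i (toral_elt v :: ('n, 'k) der)"
    if "v \<in> carrier_vec n" for i v
  proof -
    obtain \<xi> :: "'n \<Rightarrow> 'k" where \<xi>: "\<forall>j<CARD('n). v $ j = \<xi> (idx j)" by (rule vec_tor_cases)
    show ?thesis
      using that by (simp add: toral_elt_tor[OF \<xi>] phi_tor dickson_mat_moore[OF _ \<xi>] n)
  qed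
  then show "det (dickson_mat i v) = phi i (toral_elt v :: ('n, 'k) der)"
    if "v \<in> carrier_vec n" for i v using that .
  show "Delta i (toral_elt v :: ('n, 'k) der) = det (dickson_mat i v)"
    if "i \<le> n" "v \<in> carrier_vec n" for i v
  proof -
    obtain \<xi> :: "'n \<Rightarrow> 'k" where \<xi>: "\<forall>j<CARD('n). v $ j = \<xi> (idx j)" by (rule vec_tor_cases)
    show ?thesis
      using that by (simp add: toral_elt_tor[OF \<xi>] Delta_tor dickson_mat_moore[OF _ \<xi>] n moore_det_def)
  qed
  show "restrict (Delta 0) toral = (phi 0 :: ('n, 'k) der \<Rightarrow> 'k)"
  proof
    fix D :: "('n, 'k) der"
    show "restrict (Delta 0) toral D = phi 0 D"
    proof (cases "D \<in> toral")
      case True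
      then obtain \<xi> where "D = tor \<xi>" unfolding toral_eq_range_tor by blast
      with True show ?thesis by (simp add: phi_tor Delta_tor moore_det_def)
    qed (simp add: phi_def)
  qed
  show "phi 0 (toral_elt (g *\<^sub>v v) :: ('n, 'k) der) = det g * phi 0 (toral_elt v :: ('n, 'k) der)"
    if "g \<in> GL_prime n" "v \<in> carrier_vec n" for g v
  proof -
    have "g *\<^sub>v v \<in> carrier_vec n" using that by (auto simp: GL_prime_def)
    then show ?thesis
      using det_dickson_mat_GL_prime[OF that] phi_det[of v 0] phi_det[of "g *\<^sub>v v" 0] that(2) by simp
  qed
  fix i assume "i \<in> {1..n}"
  then have i: "i \<in> {1..CARD('n)}" by (simp add: n)
  show "restrict (psi (i - 1)) toral = (psi_bar (i - 1) :: ('n, 'k) der \<Rightarrow> 'k)"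
    by (rule psi_bar_eq(1)[OF i, symmetric])
  show "psi_bar (i - 1) \<in> (poly_fun_toral :: (('n, 'k) der \<Rightarrow> 'k) set)"
    unfolding psi_bar_eq(1)[OF i] by (rule psi_bar_eq(2)[OF i])
  show "phi 0 D * psi_bar (i - 1) D = - phi i D" if "D \<in> toral" for D :: "('n, 'k) der"
    unfolding psi_bar_eq(1)[OF i] by (rule psi_bar_eq(3)[OF i that])
qed

end
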